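(* Let $G$ be a 2-connected graph given with a hamiltonian pseudo-outerplanar diagram, and let $C$ be its hamiltonian boundary. Let $y\in V(C)$, and let $x,z$ be the two neighbours of $y$ on $C$, so $yx,yz\in E(C)$. Then there exists a linear forest $T\subseteq G$ satisfying all of the following: - $E(T)\subseteq\mathcal{C}(G)$; - $d_T(y)=0$; - $\max\{d_T(x),d_T(z)\}\leq 1$, where $d_T(v)=0$ if $v\notin V(T)$; - the drawing of $G-E(T)$ inherited from the diagram of $G$ has no crossings, i.e. it is an outerplanar diagram.
   Context: All graphs are finite, simple and undirected. A pseudo-outerplanar diagram of a 2-connected graph $G$ is a drawing with the following properties: the vertices lie on a circle; the edges lie inside the disk bounded by the circle; each edge crosses at most one other edge; and the number of crossings is minimum among such drawings. It is hamiltonian if, with vertices $v_1,\dots,v_n$ in clockwise order on the circle, every $v_iv_{i+1}$ (indices mod $n$) is an edge. The cycle $C=v_1v_2\cdots v_nv_1$ is then the hamiltonian boundary. Edges $v_iv_j$ with $j-i\equiv\pm1 \pmod n$ are boundary edges; all other edges are chords. $\mathcal{C}(G)$ denotes the set of chords that cross some other chord in the diagram. A linear forest is a forest whose components are paths. *)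

theory Defs
  imports "HOL-Analysis.Analysis"
begin

section \<open>Finite simple graphs\<close>

text \<open>A graph is a vertex set \<open>V\<close> together with a set \<open>E\<close> of two-element subsets of \<open>V\<close>.\<close>

definition simple_graph :: "'a set \<Rightarrow> 'a set set \<Rightarrow> bool" where
  "simple_graph V E \<longleftrightarrow> finite V \<and> (\<forall>e\<in>E. e \<subseteq> V \<and> card e = 2)"

definition vertex_degree :: "'a set set \<Rightarrow> 'a \<Rightarrow> nat" where
  "vertex_degree E v = card {e \<in> E. v \<in> e}"

definition induced_edges :: "'a set set \<Rightarrow> 'a set \<Rightarrow> 'a set set" where
  "induced_edges E W = {e \<in> E. e \<subseteq> W}"

definition adjacency :: "'a set set \<Rightarrow> ('a \<times> 'a) set" where
  "adjacency E = {(u, v). {u, v} \<in> E}"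

definition graph_connected :: "'a set \<Rightarrow> 'a set set \<Rightarrow> bool" where
  "graph_connected V E \<longleftrightarrow> V \<noteq> {} \<and> (\<forall>u\<in>V. \<forall>v\<in>V. (u, v) \<in> (adjacency E)\<^sup>*)"

definition two_connected :: "'a set \<Rightarrow> 'a set set \<Rightarrow> bool" where
  "two_connected V E \<longleftrightarrow> card V > 2 \<and>
     (\<forall>X\<subseteq>V. card X < 2 \<longrightarrow> graph_connected (V - X) (induced_edges E (V - X)))"

definition path_edges :: "'a list \<Rightarrow> 'a set set" where
  "path_edges vs = {{vs ! i, vs ! Suc i} | i. Suc i < length vs}"

definition cycle_edges :: "'a list \<Rightarrow> 'a set set" where
  "cycle_edges vs = {{vs ! i, vs ! (Suc i mod length vs)} | i. i < length vs}"

definition is_path_graph :: "'a set \<Rightarrow> 'a set set \<Rightarrow> bool" where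
  "is_path_graph V E \<longleftrightarrow> (\<exists>vs. vs \<noteq> [] \<and> distinct vs \<and> set vs = V \<and> path_edges vs = E)"

definition graph_components :: "'a set \<Rightarrow> 'a set set \<Rightarrow> 'a set set" where
  "graph_components V E = {{v \<in> V. (u, v) \<in> (adjacency E)\<^sup>*} | u. u \<in> V}"

definition forest :: "'a set \<Rightarrow> 'a set set \<Rightarrow> bool" where
  "forest V E \<longleftrightarrow> simple_graph V E \<and>
     \<not> (\<exists>vs. length vs \<ge> 3 \<and> distinct vs \<and> cycle_edges vs \<subseteq> E)"

definition linear_forest :: "'a set \<Rightarrow> 'a set set \<Rightarrow> bool" where
  "linear_forest V E \<longleftrightarrow> forest V E \<and>
     (\<forall>K \<in> graph_components V E. is_path_graph K (induced_edges E K))"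

section \<open>Drawings in a disk\<close>

record 'a drawing =
  disk_center :: complex
  disk_radius :: real
  vertex_point :: "'a \<Rightarrow> complex"
  edge_curve :: "'a set \<Rightarrow> real \<Rightarrow> complex"

definition edge_interior :: "'a drawing \<Rightarrow> 'a set \<Rightarrow> complex set" where
  "edge_interior D e = path_image (edge_curve D e) - vertex_point D ` e"

definition crossing_points :: "'a drawing \<Rightarrow> 'a set \<Rightarrow> 'a set \<Rightarrow> complex set" where
  "crossing_points D e f = edge_interior D e \<inter> edge_interior D f"

definition crosses :: "'a drawing \<Rightarrow> 'a set \<Rightarrow> 'a set \<Rightarrow> bool" where
  "crosses D e f \<longleftrightarrow> e \<noteq> f \<and> crossing_points D e f \<noteq> {}"

text \<open>Edges are arbitrary simple arcs in the closed disk, so a boundary edge may run along the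
  circle. As usual for drawings, no edge passes through a vertex other than its ends, and two edges
  have only finitely many common points; every common point other than a common end is counted as
  a crossing (so a tangential contact is not a way to avoid a crossing).\<close>

definition disk_drawing :: "'a set \<Rightarrow> 'a set set \<Rightarrow> 'a drawing \<Rightarrow> bool" where
  "disk_drawing V E D \<longleftrightarrow>
     disk_radius D > 0 \<and>
     inj_on (vertex_point D) V \<and>
     vertex_point D ` V \<subseteq> sphere (disk_center D) (disk_radius D) \<and>
     (\<forall>e\<in>E. arc (edge_curve D e) \<and>
        {pathstart (edge_curve D e), pathfinish (edge_curve D e)} = vertex_point D ` e \<and>
        path_image (edge_curve D e) \<subseteq> cball (disk_center D) (disk_radius D) \<and>
        edge_interior D e \<inter> vertex_point D ` V = {}) \<and>
     (\<forall>e\<in>E. \<forall>f\<in>E. e \<noteq> f \<longrightarrow> finite (crossing_points D e f))"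

definition number_of_crossings :: "'a set set \<Rightarrow> 'a drawing \<Rightarrow> nat" where
  "number_of_crossings E D =
     card {({e, f}, p) | e f p. e \<in> E \<and> f \<in> E \<and> e \<noteq> f \<and> p \<in> crossing_points D e f}"

definition one_crossing_drawing :: "'a set \<Rightarrow> 'a set set \<Rightarrow> 'a drawing \<Rightarrow> bool" where
  "one_crossing_drawing V E D \<longleftrightarrow> disk_drawing V E D \<and>
     (\<forall>e\<in>E. card {f \<in> E. crosses D e f} \<le> 1)"

definition pseudo_outerplanar_diagram :: "'a set \<Rightarrow> 'a set set \<Rightarrow> 'a drawing \<Rightarrow> bool" where
  "pseudo_outerplanar_diagram V E D \<longleftrightarrow> one_crossing_drawing V E D \<and>
     (\<forall>D' :: 'a drawing. one_crossing_drawing V E D' \<longrightarrow>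
        number_of_crossings E D \<le> number_of_crossings E D')"

definition outerplanar_diagram :: "'a set \<Rightarrow> 'a set set \<Rightarrow> 'a drawing \<Rightarrow> bool" where
  "outerplanar_diagram V E D \<longleftrightarrow> disk_drawing V E D \<and> (\<forall>e\<in>E. \<forall>f\<in>E. \<not> crosses D e f)"

text \<open>The list \<open>vs\<close> enumerates \<open>V\<close> in clockwise order: the angles of its entries decrease and
  go at most once around the circle.\<close>

definition clockwise_order :: "'a set \<Rightarrow> 'a drawing \<Rightarrow> 'a list \<Rightarrow> bool" where
  "clockwise_order V D vs \<longleftrightarrow> distinct vs \<and> set vs = V \<and>
     (\<exists>\<theta> :: nat \<Rightarrow> real.
        (\<forall>i < length vs. vertex_point D (vs ! i) =
           disk_center D + complex_of_real (disk_radius D) * cis (\<theta> i)) \<and>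
        (\<forall>i j. i < j \<and> j < length vs \<longrightarrow> \<theta> j < \<theta> i \<and> \<theta> i < \<theta> j + 2 * pi))"

definition hamiltonian_diagram :: "'a set \<Rightarrow> 'a set set \<Rightarrow> 'a drawing \<Rightarrow> 'a list \<Rightarrow> bool" where
  "hamiltonian_diagram V E D vs \<longleftrightarrow>
     pseudo_outerplanar_diagram V E D \<and> clockwise_order V D vs \<and> cycle_edges vs \<subseteq> E"

definition chords :: "'a set set \<Rightarrow> 'a list \<Rightarrow> 'a set set" where
  "chords E vs = E - cycle_edges vs"

definition crossing_chords :: "'a set set \<Rightarrow> 'a drawing \<Rightarrow> 'a list \<Rightarrow> 'a set set" where
  "crossing_chords E D vs = {e \<in> chords E vs. \<exists>f \<in> chords E vs. crosses D e f}"

end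

theory Submission
  imports Defs
begin

text \<open>Two edges whose ends interleave on the circle must meet in every drawing in the disk, while the
  straight-line drawing has exactly one crossing per interleaved pair and no others. Hence a drawing
  with fewest crossings has exactly the interleaved pairs as crossings, and the problem becomes one
  about chords of the cyclic sequence of vertices, each interleaved with at most one other.

  Cut the cycle at \<open>y\<close> and argue by induction on intervals \<open>[i, j]\<close>, selecting a linear forest
  that avoids \<open>i\<close> and has degree at most 1 at \<open>i + 1\<close> and \<open>j\<close>, or symmetrically. If no crossed
  chord passes over some inner point \<open>k\<close>, the selections for \<open>[i, k]\<close> and \<open>[k, j]\<close> are glued
  at \<open>k\<close>. Otherwise there is a crossing pair \<open>ic\<close>, \<open>bj\<close> with \<open>i < b < c < j\<close>; take \<open>bj\<close> and glue
  selections for \<open>[i, b]\<close>, \<open>[b, c]\<close> and \<open>[c, j]\<close> that avoid \<open>i\<close>, \<open>b\<close> and \<open>j\<close>, respectively.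

  Linear forests are handled as sets of edges between consecutive entries of a list without
  repetitions.\<close>

section \<open>Linear layouts\<close>


lemma path_edges_Nil [simp]: "path_edges [] = {}"
  and path_edges_single [simp]: "path_edges [x] = {}"
  by (auto simp: path_edges_def)

lemma path_edges_Cons [simp]:
  "path_edges (x # y # zs) = insert {x, y} (path_edges (y # zs))"
proof -
  let ?e = "\<lambda>ws i. {ws ! i, ws ! Suc i}"
  have image: "path_edges ws = ?e ws ` {..<length ws - 1}" for ws :: "'a list"
    unfolding path_edges_def by auto
  have "path_edges (x # y # zs) = ?e (x # y # zs) ` insert 0 (Suc ` {..<length (y # zs) - 1})"
    unfolding image lessThan_Suc_eq_insert_0[symmetric] by simp
  also have "\<dots> = insert {x, y} (?e (y # zs) ` {..<length (y # zs) - 1})"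
    by (simp add: image_image)
  finally show ?thesis unfolding image .
qed

lemma path_edges_append_Cons:
  "path_edges (xs @ k # ys) = path_edges (xs @ [k]) \<union> path_edges (k # ys)"
proof (induction xs)
  case (Cons x xs)
  then show ?case by (cases xs) auto
qed simp

lemma path_edges_append_subset: "path_edges xs \<union> path_edges ys \<subseteq> path_edges (xs @ ys)"
proof (induction xs)
  case (Cons x xs)
  then show ?case by (cases xs; cases ys) auto
qed simp

lemma path_edges_snoc:
  "path_edges (xs @ [x, y]) = insert {x, y} (path_edges (xs @ [x]))"
  using path_edges_append_Cons[of xs x "[y]"] by simp

lemma path_edges_rev [simp]: "path_edges (rev xs) = path_edges xs"
proof (induction xs)
  case (Cons x xs)
  then show ?case by (cases xs) (auto simp: path_edges_snoc insert_commute)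
qed simp

lemma path_edges_map: "path_edges (map f xs) = (`) f ` path_edges xs"
proof (induction xs)
  case (Cons x xs)
  then show ?case by (cases xs) auto
qed simp

lemma finite_path_edges [simp]: "finite (path_edges xs)"
proof (induction xs)
  case (Cons x xs)
  then show ?case by (cases xs) auto
qed simp

text \<open>Encodes a linear forest with ground set \<open>S\<close>: dropping edges from a path
  leaves disjoint paths, and conversely the components of a linear forest can be listed one after
  another. Isolated points are listed too. Gluing and disjoint union become operations on
  lists.\<close>

definition linear_layout :: "'a set \<Rightarrow> 'a set set \<Rightarrow> bool" where
  "linear_layout S T \<longleftrightarrow> (\<exists>L. distinct L \<and> set L = S \<and> T \<subseteq> path_edges L)"

lemma linear_layout_finite: "linear_layout S T \<Longrightarrow> finite T"
  unfolding linear_layout_def using finite_path_edges finite_subset by blast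

lemma linear_layout_empty: "finite S \<Longrightarrow> linear_layout S {}"
  unfolding linear_layout_def using finite_distinct_list by blast

lemma linear_layout_edge: "u \<noteq> v \<Longrightarrow> linear_layout {u, v} {{u, v}}"
  unfolding linear_layout_def by (intro exI[of _ "[u, v]"]) auto

lemma linear_layout_disjoint_union:
  assumes "linear_layout S T" "linear_layout S' T'" "S \<inter> S' = {}"
  shows "linear_layout (S \<union> S') (T \<union> T')"
proof -
  obtain L L' where "distinct L" "set L = S" "T \<subseteq> path_edges L"
      "distinct L'" "set L' = S'" "T' \<subseteq> path_edges L'"
    using assms unfolding linear_layout_def by blast
  then show ?thesis
    unfolding linear_layout_def using assms(3) path_edges_append_subset[of L L']
    by (intro exI[of _ "L @ L'"]) auto
qed

text \<open>Deleting the entry \<open>k\<close> destroys only consecutive pairs that contain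
  \<open>k\<close>, and none of these is in \<open>T\<close>. The new pair at the junction does no
  harm, since \<open>T\<close> need only be a subset of the pairs.\<close>

lemma linear_layout_remove:
  assumes "linear_layout S T" "k \<notin> \<Union>T"
  shows "linear_layout (S - {k}) T"
proof (cases "k \<in> S")
  case False
  then show ?thesis using assms by simp
next
  case True
  obtain L where L: "distinct L" "set L = S" "T \<subseteq> path_edges L"
    using assms unfolding linear_layout_def by blast
  then obtain A B where AB: "L = A @ k # B"
    using True split_list by metis
  have "path_edges (A @ [k]) \<subseteq> path_edges A \<union> {e. k \<in> e}"
    by (cases A rule: rev_cases) (auto simp: path_edges_snoc)
  moreover have "path_edges (k # B) \<subseteq> path_edges B \<union> {e. k \<in> e}"
    by (cases B) auto
  ultimately have "T \<subseteq> path_edges A \<union> path_edges B"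
    using L(3) AB path_edges_append_Cons[of A k B] assms(2) by blast
  then have "T \<subseteq> path_edges (A @ B)"
    using path_edges_append_subset by blast
  then show ?thesis
    unfolding linear_layout_def using L AB by (intro exI[of _ "A @ B"]) auto
qed

section \<open>Degrees, and gluing layouts at a point\<close>

lemma vertex_degree_eq_0_iff: "finite T \<Longrightarrow> vertex_degree T v = 0 \<longleftrightarrow> v \<notin> \<Union>T"
  unfolding vertex_degree_def by auto

lemma vertex_degree_Un_le: "vertex_degree (S \<union> T) v \<le> vertex_degree S v + vertex_degree T v"
proof -
  have "{e \<in> S \<union> T. v \<in> e} = {e \<in> S. v \<in> e} \<union> {e \<in> T. v \<in> e}" by auto
  then show ?thesis unfolding vertex_degree_def by (simp add: card_Un_le)
qed

lemma vertex_degree_insert_le: "vertex_degree (insert e T) v \<le> Suc (vertex_degree T v)"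
proof -
  have "card {e' \<in> {e}. v \<in> e'} \<le> card {e}" by (rule card_mono) auto
  then show ?thesis
    using vertex_degree_Un_le[of "{e}" T v] by (simp add: vertex_degree_def)
qed

text \<open>At most one of the two list edges at \<open>k\<close> belongs to \<open>T\<close>, so
  the list can be cut at the other one and the pieces rearranged until \<open>k\<close> comes
  last.\<close>

lemma linear_layout_ending_at:
  assumes "linear_layout S T" "k \<in> S" "vertex_degree T k \<le> 1"
  obtains L where "distinct (L @ [k])" "set (L @ [k]) = S" "T \<subseteq> path_edges (L @ [k])"
proof -
  obtain L where L: "distinct L" "set L = S" "T \<subseteq> path_edges L"
    using assms unfolding linear_layout_def by blast
  have fin: "finite T" using L(3) finite_path_edges finite_subset by blast
  obtain A B where AB: "L = A @ k # B"
    using assms(2) L(2) split_list by metis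
  show ?thesis
  proof (cases "A = [] \<or> B = []")
    case True
    then show ?thesis
    proof
      assume "A = []"
      have "T \<subseteq> path_edges (rev (k # B))"
        using L(3) AB \<open>A = []\<close> path_edges_rev[of "k # B"] by simp
      then show ?thesis using that[of "rev B"] L AB \<open>A = []\<close> by auto
    next
      assume "B = []"
      then show ?thesis using that[of A] L AB by auto
    qed
  next
    case False
    obtain A' a where A: "A = A' @ [a]" using False by (cases A rule: rev_cases) auto
    obtain b B' where B: "B = b # B'" using False by (cases B) auto
    have "path_edges L = path_edges A \<union> {{a, k}} \<union> {{k, b}} \<union> path_edges B"
      unfolding AB path_edges_append_Cons[of A k B] by (auto simp: A B path_edges_snoc)
    then have sub: "T \<subseteq> path_edges A \<union> {{a, k}} \<union> {{k, b}} \<union> path_edges B"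
      using L(3) by simp
    have "\<not> ({a, k} \<in> T \<and> {k, b} \<in> T)"
    proof
      assume "{a, k} \<in> T \<and> {k, b} \<in> T"
      then have "{{a, k}, {k, b}} \<subseteq> {e \<in> T. k \<in> e}" by auto
      moreover have "{a, k} \<noteq> {k, b}"
        using L(1) AB A B by (auto simp: doubleton_eq_iff)
      moreover have "finite {e \<in> T. k \<in> e}" using fin by simp
      ultimately have "card {{a, k}, {k, b}} \<le> card {e \<in> T. k \<in> e}" "card {{a, k}, {k, b}} = 2"
        by (intro card_mono card_2_iff[THEN iffD2] exI conjI; simp)+
      then show False using assms(3) unfolding vertex_degree_def by simp
    qed
    then consider "{k, b} \<notin> T" | "{a, k} \<notin> T" by blast
    then show ?thesis
    proof cases
      case 1
      \<comment> \<open>The cut is after \<open>k\<close>: the tail \<open>B\<close> moves to the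
        front.\<close>
      then have "T \<subseteq> path_edges B \<union> path_edges (A @ [k])"
        using sub unfolding A append.assoc append.simps path_edges_snoc by blast
      then have "T \<subseteq> path_edges ((B @ A) @ [k])"
        using path_edges_append_subset[of B "A @ [k]"] by auto
      then show ?thesis using that[of "B @ A"] L AB by auto
    next
      case 2
      \<comment> \<open>The cut is before \<open>k\<close>: the part from \<open>k\<close> on is
        reversed.\<close>
      have "path_edges (rev B @ [k]) = path_edges (k # B)"
        using path_edges_rev[of "k # B"] by simp
      then have "T \<subseteq> path_edges A \<union> path_edges (rev B @ [k])"
        using sub 2 unfolding B path_edges_Cons by blast
      then have "T \<subseteq> path_edges ((A @ rev B) @ [k])"
        using path_edges_append_subset[of A "rev B @ [k]"] by auto
      then show ?thesis using that[of "A @ rev B"] L AB by auto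
    qed
  qed
qed

text \<open>With \<open>k\<close> last in both lists, the first list followed by the reverse of the
  second passes through \<open>k\<close> once and has no other repetition.\<close>

lemma linear_layout_glue:
  assumes "linear_layout S T" "linear_layout S' T'" "S \<inter> S' = {k}"
    and "vertex_degree T k \<le> 1" "vertex_degree T' k \<le> 1"
  shows "linear_layout (S \<union> S') (T \<union> T')"
proof -
  obtain L where L: "distinct (L @ [k])" "set (L @ [k]) = S" "T \<subseteq> path_edges (L @ [k])"
    using linear_layout_ending_at[OF assms(1) _ assms(4)] assms(3) by blast
  obtain L' where L': "distinct (L' @ [k])" "set (L' @ [k]) = S'" "T' \<subseteq> path_edges (L' @ [k])"
    using linear_layout_ending_at[OF assms(2) _ assms(5)] assms(3) by blast
  have "T' \<subseteq> path_edges (k # rev L')"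
    using L'(3) path_edges_rev[of "k # rev L'"] by simp
  then have "T \<union> T' \<subseteq> path_edges (L @ k # rev L')"
    using L(3) path_edges_append_Cons[of L k "rev L'"] by blast
  moreover have "distinct (L @ k # rev L')"
    using L(1,2) L'(1,2) assms(3) by auto
  moreover have "set (L @ k # rev L') = S \<union> S'"
    using L(2) L'(2) by auto
  ultimately show ?thesis unfolding linear_layout_def by blast
qed

text \<open>The edge \<open>{b, j}\<close> prolongs the first layout at its point \<open>b\<close>.
  Since \<open>T2\<close> avoids \<open>b\<close> and \<open>T3\<close> avoids \<open>j\<close>,
  these points can be deleted from the other two layouts; those are glued at \<open>c\<close> and
  are then disjoint from the prolonged one. In the application the three sets are consecutive
  intervals, taken in either direction.\<close>

lemma linear_layout_chain:
  assumes "linear_layout A T1" "linear_layout B T2" "linear_layout C T3"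
    and "A \<inter> B = {b}" "B \<inter> C = {c}" "A \<inter> C = {}" "j \<in> C" "j \<noteq> c"
    and "vertex_degree T1 b \<le> 1" "vertex_degree T2 b = 0" "vertex_degree T2 c \<le> 1"
    and "vertex_degree T3 c \<le> 1" "vertex_degree T3 j = 0"
  shows "linear_layout (A \<union> B \<union> C) (T1 \<union> T2 \<union> T3 \<union> {{b, j}})"
proof -
  have "b \<noteq> j" using assms(4,6,7) by auto
  have "vertex_degree {{b, j}} b \<le> 1"
    using vertex_degree_insert_le[of "{b, j}" "{}" b] by (simp add: vertex_degree_def)
  moreover have "A \<inter> {b, j} = {b}" using assms(4,6,7) by auto
  ultimately have 1: "linear_layout (A \<union> {b, j}) (T1 \<union> {{b, j}})"
    using linear_layout_glue[OF assms(1) linear_layout_edge[OF \<open>b \<noteq> j\<close>]] assms(9) by simp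
  have "linear_layout (B - {b}) T2"
    using assms(2,10) linear_layout_remove vertex_degree_eq_0_iff linear_layout_finite by metis
  moreover have "linear_layout (C - {j}) T3"
    using assms(3,13) linear_layout_remove vertex_degree_eq_0_iff linear_layout_finite by metis
  moreover have "(B - {b}) \<inter> (C - {j}) = {c}" using assms(4-8) by auto
  ultimately have 2: "linear_layout ((B - {b}) \<union> (C - {j})) (T2 \<union> T3)"
    using linear_layout_glue assms(11,12) by metis
  have "(A \<union> {b, j}) \<inter> ((B - {b}) \<union> (C - {j})) = {}" using assms(4-8) by auto
  from linear_layout_disjoint_union[OF 1 2 this] 
  have "linear_layout ((A \<union> {b, j}) \<union> ((B - {b}) \<union> (C - {j}))) (T1 \<union> {{b, j}} \<union> (T2 \<union> T3))" .
  moreover have "(A \<union> {b, j}) \<union> ((B - {b}) \<union> (C - {j})) = A \<union> B \<union> C" using assms(4-8) by auto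
  moreover have "T1 \<union> {{b, j}} \<union> (T2 \<union> T3) = T1 \<union> T2 \<union> T3 \<union> {{b, j}}" by auto
  ultimately show ?thesis by simp
qed

text \<open>On a cycle, consider the vertex that comes first in the list \<open>L\<close>. Both its
  neighbours on the cycle must be its immediate successor in \<open>L\<close>, so they coincide,
  which is impossible on a cycle with at least three vertices.\<close>

lemma linear_layout_forest:
  assumes "simple_graph V T" "linear_layout V T"
  shows "forest V T"
  unfolding forest_def
proof (intro conjI notI assms(1))
  assume "\<exists>cs. 3 \<le> length cs \<and> distinct cs \<and> cycle_edges cs \<subseteq> T"
  then obtain cs where cs: "3 \<le> length cs" "distinct cs" "cycle_edges cs \<subseteq> T" by blast
  obtain L where L: "distinct L" "T \<subseteq> path_edges L"
    using assms(2) unfolding linear_layout_def by blast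
  define pos where "pos = inv_into {..<length L} (nth L)"
  have pos: "pos (L ! i) = i" if "i < length L" for i
    unfolding pos_def using that L(1) by (intro inv_into_f_f) (auto simp: inj_on_nth)
  have adj: "(pos u = Suc (pos v) \<or> pos v = Suc (pos u)) \<and> L ! pos u = u" if "{u, v} \<in> path_edges L" for u v
    using that pos unfolding path_edges_def by (auto simp: doubleton_eq_iff)
  let ?n = "length cs"
  have edge: "{cs ! i, cs ! (Suc i mod ?n)} \<in> path_edges L" if "i < ?n" for i
    using that cs(3) L(2) unfolding cycle_edges_def by blast
  have ex: "0 < ?n" using cs(1) by linarith
  obtain m where m: "m < ?n" "\<And>i. i < ?n \<Longrightarrow> pos (cs ! m) \<le> pos (cs ! i)"
    using ex_has_least_nat[of "\<lambda>i. i < ?n" 0 "\<lambda>i. pos (cs ! i)"] ex by blast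
  define m1 where "m1 = Suc m mod ?n"
  \<comment> \<open>The cyclic predecessor of \<open>m\<close>, with the wrap-around at 0 made
    explicit. It differs from the successor \<open>m1\<close> because the cycle has length at least
    3.\<close>
  define m0 where "m0 = (if m = 0 then ?n - 1 else m - 1)"
  have ms: "m1 < ?n" "m0 < ?n" "Suc m0 mod ?n = m" "m0 \<noteq> m1"
    using m(1) cs(1) by (auto simp: m1_def m0_def mod_Suc split: if_splits)
  have e1: "{cs ! m, cs ! m1} \<in> path_edges L" using edge[OF m(1)] m1_def by simp
  have e0: "{cs ! m0, cs ! m} \<in> path_edges L" using edge[OF ms(2)] ms(3) by simp
  have "pos (cs ! m1) = Suc (pos (cs ! m))" using adj[OF e1] m(2)[OF ms(1)] by linarith
  moreover have "pos (cs ! m0) = Suc (pos (cs ! m))" using adj[OF e0] m(2)[OF ms(2)] by linarith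
  ultimately have "cs ! m1 = cs ! m0"
    using adj[OF e0] adj[of "cs ! m1" "cs ! m"] e1 by (metis insert_commute)
  then show False using cs(2) ms nth_eq_iff_index_eq by metis
qed

text \<open>The component of \<open>L ! m\<close> is the maximal run of positions around
  \<open>m\<close> whose consecutive pairs all lie in \<open>T\<close>. An edge of \<open>T\<close>
  moves by one position, so leaving the run would extend it beyond \<open>lo\<close> or
  \<open>hi\<close>.\<close>

lemma linear_layout_component_path:
  assumes L: "distinct L" "T \<subseteq> path_edges L" and m: "m < length L"
  defines "K \<equiv> {v \<in> set L. (L ! m, v) \<in> (adjacency T)\<^sup>*}"
  shows "is_path_graph K (induced_edges T K)"
proof -
  let ?e = "\<lambda>k. {L ! k, L ! Suc k}"
  \<comment> \<open>\<open>R\<close> and \<open>Q\<close> hold the possible right and left ends of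
    such runs; \<open>hi\<close> and \<open>lo\<close> are the extreme ones.\<close>
  define R where "R = {h. m \<le> h \<and> h < length L \<and> (\<forall>k. m \<le> k \<and> k < h \<longrightarrow> ?e k \<in> T)}"
  define Q where "Q = {l. l \<le> m \<and> (\<forall>k. l \<le> k \<and> k < m \<longrightarrow> ?e k \<in> T)}"
  define hi where "hi = Max R"
  define lo where "lo = Min Q"
  have "finite R" "m \<in> R" using m by (auto simp: R_def)
  then have hi: "hi \<in> R" "\<And>h. h \<in> R \<Longrightarrow> h \<le> hi" unfolding hi_def by (auto intro: Max_in)
  have "finite Q" "m \<in> Q" by (auto simp: Q_def)
  then have lo: "lo \<in> Q" "\<And>h. h \<in> Q \<Longrightarrow> lo \<le> h" unfolding lo_def by (auto intro: Min_in)
  have bnd: "lo \<le> m" "m \<le> hi" "hi < length L" using hi lo by (auto simp: R_def Q_def)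
  have seg: "?e k \<in> T" if "lo \<le> k" "k < hi" for k
    using that hi lo by (cases "k < m") (auto simp: R_def Q_def)
  have inj: "L ! i = L ! k \<longleftrightarrow> i = k" if "i < length L" "k < length L" for i k
    using that L(1) nth_eq_iff_index_eq by blast
  have Kseg: "K = (!) L ` {lo..hi}"
  proof (intro equalityI subsetI)
    fix v assume "v \<in> K"
    then have "(L ! m, v) \<in> (adjacency T)\<^sup>*" unfolding K_def by simp
    then show "v \<in> (!) L ` {lo..hi}"
    proof (induction rule: rtrancl_induct)
      case base
      then show ?case using bnd by auto
    next
      case (step v w)
      then obtain k where k: "lo \<le> k" "k \<le> hi" "v = L ! k" by auto
      have T: "{v, w} \<in> T" using step(2) by (simp add: adjacency_def)
      then obtain i where i: "Suc i < length L" "{v, w} = ?e i"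
        using L(2) unfolding path_edges_def by blast
      then consider "i = k" "w = L ! Suc k" | "k = Suc i" "w = L ! i"
        using k bnd inj by (auto simp: doubleton_eq_iff)
      then show ?case
      proof cases
        case 1
        have "k \<noteq> hi"
        proof
          assume "k = hi"
          then have "Suc hi \<in> R"
            using hi(1) i 1 T k by (auto simp: R_def less_Suc_eq)
          then show False using hi(2) by fastforce
        qed
        then show ?thesis using 1 k by auto
      next
        case 2
        have "k \<noteq> lo"
        proof
          assume "k = lo"
          have "?e i' \<in> T" if "i \<le> i'" "i' < m" for i'
          proof (cases "i' = i")
            case True
            then show ?thesis using i T by simp
          next
            case False
            then show ?thesis using lo(1) \<open>k = lo\<close> 2 that by (auto simp: Q_def)
          qed
          then have "i \<in> Q"
            using bnd \<open>k = lo\<close> 2 by (auto simp: Q_def)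
          then show False using lo(2) \<open>k = lo\<close> 2 by fastforce
        qed
        then show ?thesis using 2 k by auto
      qed
    qed
  next
    fix v assume "v \<in> (!) L ` {lo..hi}"
    then obtain k where k: "lo \<le> k" "k \<le> hi" "v = L ! k" by auto
    have right: "(L ! m, L ! k) \<in> (adjacency T)\<^sup>*" if "m \<le> k" "k \<le> hi" for k
      using that
    proof (induction k rule: dec_induct)
      case (step k)
      have "(L ! k, L ! Suc k) \<in> adjacency T"
        using seg[of k] step bnd by (simp add: adjacency_def)
      then show ?case using step by (auto intro: rtrancl_into_rtrancl)
    qed simp
    have left: "(L ! m, L ! k) \<in> (adjacency T)\<^sup>*" if "k \<le> m" "lo \<le> k" for k
      using that
    proof (induction k rule: inc_induct)
      case (step k)
      have "(L ! Suc k, L ! k) \<in> adjacency T"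
        using seg[of k] step bnd by (simp add: adjacency_def insert_commute)
      then show ?case using step by (auto intro: rtrancl_into_rtrancl)
    qed simp
    show "v \<in> K"
      unfolding K_def using k right[of k] left[of k] bnd by (cases "k \<le> m") auto
  qed
  let ?M = "map ((!) L) [lo..<Suc hi]"
  have "induced_edges T K = path_edges ?M"
  proof (intro equalityI subsetI)
    fix e assume "e \<in> induced_edges T K"
    then have e: "e \<in> T" "e \<subseteq> K" unfolding induced_edges_def by auto
    then obtain i where i: "Suc i < length L" "e = ?e i"
      using L(2) unfolding path_edges_def by blast
    then have "lo \<le> i" "Suc i \<le> hi"
      using e(2) bnd inj unfolding Kseg by auto
    then have "Suc (i - lo) < length ?M" "e = {?M ! (i - lo), ?M ! Suc (i - lo)}"
      using i by (auto simp del: upt_Suc simp: nth_map)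
    then show "e \<in> path_edges ?M" unfolding path_edges_def by blast
  next
    fix e assume "e \<in> path_edges ?M"
    then obtain i where i: "Suc i < length ?M" "e = {?M ! i, ?M ! Suc i}"
      unfolding path_edges_def by blast
    then have "e = ?e (lo + i)" "lo + i < hi" by (auto simp del: upt_Suc simp: nth_map)
    then show "e \<in> induced_edges T K"
      using seg[of "lo + i"] unfolding induced_edges_def Kseg by auto
  qed
  moreover have "distinct ?M"
    using L(1) bnd inj by (auto simp del: upt_Suc simp: distinct_map inj_on_def)
  moreover have "set ?M = K" unfolding Kseg by (auto simp del: upt_Suc)
  moreover have "?M \<noteq> []" using bnd by simp
  ultimately show ?thesis unfolding is_path_graph_def by metis
qed

lemma linear_layout_linear_forest:
  assumes "simple_graph V T" "linear_layout V T"
  shows "linear_forest V T"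
  unfolding linear_forest_def
proof (intro conjI ballI linear_layout_forest assms)
  fix K assume "K \<in> graph_components V T"
  moreover obtain L where L: "distinct L" "set L = V" "T \<subseteq> path_edges L"
    using assms(2) unfolding linear_layout_def by blast
  ultimately obtain m where "m < length L" "K = {v \<in> set L. (L ! m, v) \<in> (adjacency T)\<^sup>*}"
    unfolding graph_components_def by (auto simp: in_set_conv_nth)
  then show "is_path_graph K (induced_edges T K)"
    using linear_layout_component_path[OF L(1,3)] by blast
qed

section \<open>Resolving interleaved pairs of a cyclic order\<close>


text \<open>The combinatorial form of a crossing. Alternation of four ends in the linear order is
  the same as alternation around the circle, so it does not matter where the cycle is cut.\<close>

definition interleaved :: "nat set \<Rightarrow> nat set \<Rightarrow> bool" where
  "interleaved s t \<longleftrightarrow> (\<exists>a b c d. a < b \<and> b < c \<and> c < d \<and>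
     (s = {a, c} \<and> t = {b, d} \<or> s = {b, d} \<and> t = {a, c}))"

lemma interleaved_sym: "interleaved s t \<Longrightarrow> interleaved t s"
  unfolding interleaved_def by blast

lemma interleaved_pairs:
  assumes "p < q" "k < l"
  shows "interleaved {p, q} {k, l} \<longleftrightarrow> p < k \<and> k < q \<and> q < l \<or> k < p \<and> p < l \<and> l < q"
  unfolding interleaved_def using assms by (fastforce simp: doubleton_eq_iff)

lemma interleaved_pair_left:
  assumes "interleaved s t"
  obtains p q where "s = {p, q}" "p < q"
  using assms unfolding interleaved_def by (metis less_trans)

text \<open>The wanted forest, on a stretch of the cut cycle and in terms of indices. The layout
  lists the whole interval, so solutions on adjacent intervals share exactly one point, as gluing
  requires. Degree bounds are stated separately because they differ between the two mirror-image
  versions.\<close>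

definition uncrossing :: "nat set set \<Rightarrow> nat \<Rightarrow> nat \<Rightarrow> nat set set \<Rightarrow> bool" where
  "uncrossing F i j T \<longleftrightarrow> linear_layout {i..j} T \<and>
     (\<forall>s\<in>T. s \<in> F \<and> s \<subseteq> {i..j} \<and> (\<exists>t\<in>F. t \<subseteq> {i..j} \<and> interleaved s t)) \<and>
     (\<forall>s\<in>F. \<forall>t\<in>F. s \<subseteq> {i..j} \<and> t \<subseteq> {i..j} \<and> interleaved s t \<longrightarrow> s \<in> T \<or> t \<in> T)"

lemma uncrossingI:
  assumes "linear_layout {i..j} T"
    and "\<And>s. s \<in> T \<Longrightarrow> s \<in> F \<and> s \<subseteq> {i..j} \<and> (\<exists>t\<in>F. t \<subseteq> {i..j} \<and> interleaved s t)"
    and "\<And>s t. s \<in> F \<Longrightarrow> t \<in> F \<Longrightarrow> s \<subseteq> {i..j} \<Longrightarrow> t \<subseteq> {i..j} \<Longrightarrow> interleaved s t \<Longrightarrow>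
      s \<in> T \<or> t \<in> T"
  shows "uncrossing F i j T"
  using assms unfolding uncrossing_def by metis

lemma uncrossing_member:
  assumes "uncrossing F i j T" "s \<in> T"
  obtains t where "s \<in> F" "t \<in> F" "s \<subseteq> {i..j}" "t \<subseteq> {i..j}" "interleaved s t"
  using assms unfolding uncrossing_def by metis

lemma uncrossing_member_mono:
  assumes "uncrossing F p q T" "s \<in> T" "i \<le> p" "q \<le> j"
  shows "s \<in> F \<and> s \<subseteq> {i..j} \<and> (\<exists>t\<in>F. t \<subseteq> {i..j} \<and> interleaved s t)"
proof -
  obtain t where "s \<in> F" "t \<in> F" "s \<subseteq> {p..q}" "t \<subseteq> {p..q}" "interleaved s t"
    using uncrossing_member[OF assms(1,2)] .
  moreover have "{p..q} \<subseteq> {i..j}" using assms(3,4) by simp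
  ultimately show ?thesis by (metis subset_trans)
qed

lemma uncrossing_hits:
  assumes "uncrossing F i j T" "s \<in> F" "t \<in> F" "s \<subseteq> {i..j}" "t \<subseteq> {i..j}" "interleaved s t"
  shows "s \<in> T \<or> t \<in> T"
  using assms unfolding uncrossing_def by metis

lemma uncrossing_layout: "uncrossing F i j T \<Longrightarrow> linear_layout {i..j} T"
  unfolding uncrossing_def by (rule conjunct1)

lemma uncrossing_degree_0:
  assumes "uncrossing F i j T" "v \<notin> {i..j}"
  shows "vertex_degree T v = 0"
proof -
  have "v \<notin> s" if "s \<in> T" for s
    using uncrossing_member[OF assms(1) that] assms(2) by (metis subsetD)
  then have none: "{s \<in> T. v \<in> s} = {}" by blast
  show ?thesis unfolding vertex_degree_def none by simp
qed

text \<open>Two points leave no room for four distinct ends. This matters when a newly selected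
  chord ends at the point next to an end of the interval and must be the only selected chord
  there.\<close>

lemma uncrossing_short:
  assumes "uncrossing F i (Suc i) T"
  shows "T = {}"
proof (rule ccontr)
  assume "T \<noteq> {}"
  then obtain s where "s \<in> T" by blast
  then obtain t where "s \<subseteq> {i..Suc i}" "t \<subseteq> {i..Suc i}" "interleaved s t"
    using uncrossing_member[OF assms] by metis
  then show False unfolding interleaved_def by auto
qed

text \<open>Strong induction on the length of the interval. The two mirror-image versions are proved
  together, because around a crossing pair each of them needs selections of both kinds on the
  subintervals. The bounds at \<open>Suc i\<close> and \<open>j\<close> finally become the bounds at
  the two neighbours of the avoided vertex.\<close>

lemma uncrossing_exists:
  fixes F :: "nat set set"
  assumes one: "\<And>s t u. s \<in> F \<Longrightarrow> t \<in> F \<Longrightarrow> u \<in> F \<Longrightarrow> interleaved s t \<Longrightarrow> interleaved s u \<Longrightarrow> t = u"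
    and "i < j"
  shows "(\<exists>T. uncrossing F i j T \<and> vertex_degree T i = 0 \<and>
            vertex_degree T (Suc i) \<le> 1 \<and> vertex_degree T j \<le> 1) \<and>
         (\<exists>T. uncrossing F i j T \<and> vertex_degree T j = 0 \<and>
            vertex_degree T (j - 1) \<le> 1 \<and> vertex_degree T i \<le> 1)"
  using \<open>i < j\<close>
proof (induction "j - i" arbitrary: i j rule: less_induct)
  case less
  have left: "\<exists>T. uncrossing F p q T \<and> vertex_degree T p = 0 \<and>
      vertex_degree T (Suc p) \<le> 1 \<and> vertex_degree T q \<le> 1"
    and right: "\<exists>T. uncrossing F p q T \<and> vertex_degree T q = 0 \<and>
      vertex_degree T (q - 1) \<le> 1 \<and> vertex_degree T p \<le> 1"
    if "p < q" "i \<le> p" "q \<le> j" "i < p \<or> q < j" for p q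
    using less.hyps[of q p] that by auto
  have un: "vertex_degree (S \<union> T) v \<le> a + b" if "vertex_degree S v \<le> a" "vertex_degree T v \<le> b"
    for S T :: "nat set set" and v a b
    using that vertex_degree_Un_le[of S T v] by linarith
  define X where "X s t \<longleftrightarrow> s \<in> F \<and> t \<in> F \<and> s \<subseteq> {i..j} \<and> t \<subseteq> {i..j} \<and> interleaved s t" for s t
  have X_sym: "X s t \<Longrightarrow> X t s" for s t unfolding X_def using interleaved_sym by blast
  have X_pair: "\<exists>p q. s = {p, q} \<and> p < q \<and> i \<le> p \<and> q \<le> j" if "X s t" for s t
  proof -
    from that obtain p q where "s = {p, q}" "p < q"
      unfolding X_def by (metis interleaved_pair_left)
    moreover from this have "i \<le> p" "q \<le> j" using that unfolding X_def by simp_all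
    ultimately show ?thesis by blast
  qed
  have X_one: "X s t \<Longrightarrow> u \<in> F \<Longrightarrow> u \<subseteq> {i..j} \<Longrightarrow> interleaved s u \<Longrightarrow> t = u" for s t u
    unfolding X_def using one by blast
  show ?case
  proof (cases "\<exists>k. i < k \<and> k < j \<and> (\<forall>p q t. X {p, q} t \<longrightarrow> \<not> (p < k \<and> k < q))")
    case True
    then obtain k where k: "i < k" "k < j" "\<And>p q t. X {p, q} t \<Longrightarrow> \<not> (p < k \<and> k < q)" by blast
    \<comment> \<open>Of two interleaved chords, each has an end strictly between the ends of the
      other. As neither passes over \<open>k\<close>, they lie on the same side of it.\<close>
    have halves: "s \<subseteq> {i..k} \<and> t \<subseteq> {i..k} \<or> s \<subseteq> {k..j} \<and> t \<subseteq> {k..j}" if st: "X s t" for s t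
    proof -
      obtain p q where pq: "s = {p, q}" "p < q" "i \<le> p" "q \<le> j" using X_pair[OF st] by blast
      obtain p' q' where pq': "t = {p', q'}" "p' < q'" "i \<le> p'" "q' \<le> j"
        using X_pair[OF X_sym[OF st]] by blast
      have "\<not> (p < k \<and> k < q)" "\<not> (p' < k \<and> k < q')"
        using k(3) st X_sym[OF st] pq(1) pq'(1) by blast+
      moreover have "interleaved {p, q} {p', q'}" using st pq(1) pq'(1) unfolding X_def by simp
      ultimately have "q \<le> k \<and> q' \<le> k \<or> k \<le> p \<and> k \<le> p'"
        unfolding interleaved_pairs[OF pq(2) pq'(2)] by linarith
      then show ?thesis using pq pq' by (elim disjE) simp_all
    qed
    have join: "uncrossing F i j (T \<union> T')"
      if T: "uncrossing F i k T" "vertex_degree T k \<le> 1"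
        and T': "uncrossing F k j T'" "vertex_degree T' k \<le> 1" for T T'
    proof -
      have "{i..k} \<inter> {k..j} = {k}" "{i..k} \<union> {k..j} = {i..j}" using k by auto
      then have "linear_layout {i..j} (T \<union> T')"
        using linear_layout_glue[of "{i..k}" T "{k..j}" T' k] T T' uncrossing_layout by metis
      moreover have "s \<in> F \<and> s \<subseteq> {i..j} \<and> (\<exists>t\<in>F. t \<subseteq> {i..j} \<and> interleaved s t)"
        if "s \<in> T \<union> T'" for s
        using uncrossing_member_mono[OF T(1), of _ i j] uncrossing_member_mono[OF T'(1), of _ i j] k that
        by (metis Un_iff less_imp_le order_refl)
      moreover have "s \<in> T \<union> T' \<or> t \<in> T \<union> T'" if "X s t" for s t
        using halves[OF that] that uncrossing_hits[OF T(1)] uncrossing_hits[OF T'(1)]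
        unfolding X_def by (metis Un_iff)
      ultimately show ?thesis unfolding X_def by (intro uncrossingI) auto
    qed
    obtain T1 where T1: "uncrossing F i k T1" "vertex_degree T1 i = 0"
        "vertex_degree T1 (Suc i) \<le> 1" "vertex_degree T1 k \<le> 1"
      using left[of i k] k by auto
    obtain T2 where T2: "uncrossing F k j T2" "vertex_degree T2 k = 0" "vertex_degree T2 j \<le> 1"
      using left[of k j] k by auto
    obtain T3 where T3: "uncrossing F i k T3" "vertex_degree T3 k = 0" "vertex_degree T3 i \<le> 1"
      using right[of i k] k by auto
    obtain T4 where T4: "uncrossing F k j T4" "vertex_degree T4 j = 0"
        "vertex_degree T4 (j - 1) \<le> 1" "vertex_degree T4 k \<le> 1"
      using right[of k j] k by auto
    \<comment> \<open>If \<open>Suc i\<close> is \<open>k\<close>, then \<open>T2\<close> avoids it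
      by choice; otherwise it lies outside \<open>{k..j}\<close>. The point \<open>j - 1\<close> is
      treated symmetrically with \<open>T3\<close>.\<close>
    have "vertex_degree T2 (Suc i) = 0"
      using uncrossing_degree_0[OF T2(1), of "Suc i"] T2(2) k by (cases "Suc i = k") auto
    moreover have "vertex_degree T3 (j - 1) = 0"
    proof (cases "j - 1 = k")
      case False
      then have "j - 1 \<notin> {i..k}" using k by auto
      then show ?thesis by (rule uncrossing_degree_0[OF T3(1)])
    qed (use T3(2) in simp)
    moreover have "vertex_degree T1 j = 0" "vertex_degree T2 i = 0"
        "vertex_degree T3 j = 0" "vertex_degree T4 i = 0"
      using uncrossing_degree_0 T1(1) T2(1) T3(1) T4(1) k by auto
    ultimately have "vertex_degree (T1 \<union> T2) i = 0" "vertex_degree (T1 \<union> T2) (Suc i) \<le> 1"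
        "vertex_degree (T1 \<union> T2) j \<le> 1" "vertex_degree (T3 \<union> T4) j = 0"
        "vertex_degree (T3 \<union> T4) (j - 1) \<le> 1" "vertex_degree (T3 \<union> T4) i \<le> 1"
      using T1 T2 T3 T4
        un[of T1 i 0 T2 0] un[of T1 "Suc i" 1 T2 0] un[of T1 j 0 T2 1]
        un[of T3 j 0 T4 0] un[of T3 "j - 1" 0 T4 1] un[of T3 i 1 T4 0] by simp_all
    moreover have "uncrossing F i j (T1 \<union> T2)" "uncrossing F i j (T3 \<union> T4)"
      using join T1 T2 T3 T4 by simp_all
    ultimately show ?thesis by blast
  next
    case False
    then have cover: "\<exists>p q t. X {p, q} t \<and> p < k \<and> k < q" if "i < k" "k < j" for k
      using that by blast
    show ?thesis
    proof (cases "j = Suc i")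
      case True
      have "\<not> X s t" for s t
        unfolding X_def interleaved_def using True by auto
      then have "uncrossing F i j {}"
        unfolding X_def by (intro uncrossingI) (auto intro: linear_layout_empty)
      then show ?thesis by (auto simp: vertex_degree_def intro!: exI[of _ "{}"])
    next
      case False
      \<comment> \<open>A crossing pair with smallest end \<open>i\<close> and maximal largest end must reach \<open>j\<close>,
        since otherwise the edge covering that end would start at \<open>i\<close> and reach further.\<close>
      define P where "P d \<longleftrightarrow> (\<exists>b c. i < b \<and> b < c \<and> c < d \<and> X {i, c} {b, d})" for d
      \<comment> \<open>The partner of \<open>{i, q}\<close> cannot begin before \<open>i\<close>,
        so it begins strictly inside and ends beyond \<open>q\<close>.\<close>
      have start: "\<exists>d. q < d \<and> P d" if iq: "X {i, q} t" "i < q" for q t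
      proof -
        obtain b d where bd: "t = {b, d}" "b < d" "i \<le> b" "d \<le> j"
          using X_pair[OF X_sym[OF iq(1)]] by blast
        then have "b < q" "q < d" "i < b"
          using iq interleaved_pairs[OF iq(2) bd(2)] unfolding X_def by auto
        then show ?thesis unfolding P_def using iq(1) bd(1) by blast
      qed
      have P_le: "d \<le> j" if "P d" for d
        using that unfolding P_def X_def by auto
      \<comment> \<open>A crossed chord passing over \<open>Suc i\<close> can only begin at
        \<open>i\<close>, so some \<open>d\<close> satisfies \<open>P\<close>.\<close>
      obtain p q t where "X {p, q} t" "p < Suc i" "Suc i < q"
        using cover[of "Suc i"] False less.prems by auto
      moreover from this have "p = i" unfolding X_def by auto
      ultimately have "\<exists>d. P d" using start[of q t] by auto
      then obtain d where d: "P d" "\<And>d'. P d' \<Longrightarrow> d' \<le> d"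
        using P_le GreatestI_ex_nat[of P j] Greatest_le_nat[of P _ j] by blast
      obtain b c where bc: "i < b" "b < c" "c < d" "X {i, c} {b, d}"
        using d(1) unfolding P_def by blast
      have "d = j"
      proof (rule ccontr)
        assume "d \<noteq> j"
        then obtain p q t where pq: "X {p, q} t" "p < d" "d < q"
          using cover[of d] P_le[OF d(1)] bc by auto
        have in_ij: "i \<le> p" "q \<le> j" "{p, q} \<in> F" "{p, q} \<subseteq> {i..j}" using pq unfolding X_def by auto
        have ne: "{p, q} \<noteq> {b, d}" "{p, q} \<noteq> {i, c}" using pq bc by (auto simp: doubleton_eq_iff)
        \<comment> \<open>The two chords of the pair are each other's only partners, so the chord
          over \<open>d\<close> crosses neither. Beginning at \<open>b\<close> or between
          \<open>i\<close> and \<open>b\<close> it would cross \<open>{i, c}\<close>, and beginning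
          between \<open>b\<close> and \<open>d\<close> it would cross \<open>{b, d}\<close>; only
          \<open>i\<close> is left.\<close>
        have "\<not> interleaved {i, c} {p, q}"
          using X_one[OF bc(4) in_ij(3,4)] ne by blast
        moreover have "\<not> interleaved {b, d} {p, q}"
          using X_one[OF X_sym[OF bc(4)] in_ij(3,4)] ne by blast
        ultimately have "p = i"
          using interleaved_pairs[of i c p q] interleaved_pairs[of b d p q] pq bc in_ij by auto
        then obtain d' where "q < d'" "P d'" using start pq bc by fastforce
        then show False using d(2) pq by fastforce
      qed
      then have bc: "i < b" "b < c" "c < j" "X {i, c} {b, j}" using bc by auto
      \<comment> \<open>A chord crossing neither member of the pair lies in one of the three parts
        or is \<open>{i, j}\<close>, and nothing inside the interval crosses the latter.\<close>
      have X_other: "s \<subseteq> {i..b} \<or> s \<subseteq> {b..c} \<or> s \<subseteq> {c..j}"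
        if st: "X s t" "s \<noteq> {i, c}" "s \<noteq> {b, j}" for s t
      proof -
        obtain p q where pq: "s = {p, q}" "p < q" "i \<le> p" "q \<le> j" using X_pair[OF st(1)] by blast
        obtain p' q' where pq': "t = {p', q'}" "p' < q'" "i \<le> p'" "q' \<le> j"
          using X_pair[OF X_sym[OF st(1)]] by blast
        have "\<not> interleaved {i, c} {p, q}"
          using X_one[OF bc(4)] st pq(1) unfolding X_def by metis
        moreover have "\<not> interleaved {b, j} {p, q}"
          using X_one[OF X_sym[OF bc(4)]] st pq(1) unfolding X_def by metis
        moreover have "\<not> (p = i \<and> q = j)"
          using st(1) pq' pq interleaved_pairs[OF pq(2) pq'(2)] unfolding X_def by auto
        moreover have "i < c" "b < j" using bc by simp_all
        ultimately have "q \<le> b \<or> b \<le> p \<and> q \<le> c \<or> c \<le> p"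
          using interleaved_pairs[OF \<open>i < c\<close> pq(2)] interleaved_pairs[OF \<open>b < j\<close> pq(2)] pq(3,4) bc(1-3)
          by linarith
        then show ?thesis using pq by (elim disjE) simp_all
      qed
      \<comment> \<open>Chords lying in different parts overlap in at most an end, so they cannot
        interleave.\<close>
      have parts: "s \<subseteq> {i..b} \<and> t \<subseteq> {i..b} \<or> s \<subseteq> {b..c} \<and> t \<subseteq> {b..c} \<or> s \<subseteq> {c..j} \<and> t \<subseteq> {c..j}"
        if st: "X s t" "{s, t} \<noteq> {{i, c}, {b, j}}" for s t
      proof -
        have s: "s \<noteq> {i, c}" "s \<noteq> {b, j}"
          using X_one[OF bc(4)] X_one[OF X_sym[OF bc(4)]] st unfolding X_def
          by (metis insert_commute)+
        have t: "t \<noteq> {i, c}" "t \<noteq> {b, j}"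
          using X_one[OF bc(4), of s] X_one[OF X_sym[OF bc(4)], of s] st interleaved_sym unfolding X_def
          by (metis insert_commute)+
        obtain p q where pq: "s = {p, q}" "p < q" "i \<le> p" "q \<le> j"
          using X_pair[OF st(1)] by blast
        obtain p' q' where pq': "t = {p', q'}" "p' < q'" "i \<le> p'" "q' \<le> j"
          using X_pair[OF X_sym[OF st(1)]] by blast
        have "interleaved {p, q} {p', q'}" using st(1) pq(1) pq'(1) unfolding X_def by simp
        then have "p < p' \<and> p' < q \<and> q < q' \<or> p' < p \<and> p < q' \<and> q' < q"
          using interleaved_pairs[OF pq(2) pq'(2)] by simp
        moreover have "q \<le> b \<or> b \<le> p \<and> q \<le> c \<or> c \<le> p"
          using X_other[OF st(1) s] pq by auto
        moreover have "q' \<le> b \<or> b \<le> p' \<and> q' \<le> c \<or> c \<le> p'"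
          using X_other[OF X_sym[OF st(1)] t] pq' by auto
        ultimately have "q \<le> b \<and> q' \<le> b \<or> b \<le> p \<and> q \<le> c \<and> b \<le> p' \<and> q' \<le> c \<or> c \<le> p \<and> c \<le> p'"
          using bc by linarith
        then show ?thesis using pq pq' by (elim disjE) simp_all
      qed
      \<comment> \<open>Either member \<open>e\<close> of the pair resolves their crossing, so this
        serves both versions.\<close>
      have join: "uncrossing F i j (T1 \<union> T2 \<union> T3 \<union> {e})"
        if T: "uncrossing F i b T1" "uncrossing F b c T2" "uncrossing F c j T3"
          and layout: "linear_layout {i..j} (T1 \<union> T2 \<union> T3 \<union> {e})"
          and e: "e = {i, c} \<or> e = {b, j}" for T1 T2 T3 e
      proof -
        have "s \<in> F \<and> s \<subseteq> {i..j} \<and> (\<exists>t\<in>F. t \<subseteq> {i..j} \<and> interleaved s t)"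
          if s: "s \<in> T1 \<union> T2 \<union> T3 \<union> {e}" for s
        proof (cases "s = e")
          case True
          then show ?thesis using e bc(4) X_sym[OF bc(4)] unfolding X_def by blast
        next
          case False
          then consider "s \<in> T1" | "s \<in> T2" | "s \<in> T3" using s by blast
          then show ?thesis
          proof cases
            case 1
            then show ?thesis using uncrossing_member_mono[OF T(1), of s i j] bc by simp
          next
            case 2
            then show ?thesis using uncrossing_member_mono[OF T(2), of s i j] bc by simp
          next
            case 3
            then show ?thesis using uncrossing_member_mono[OF T(3), of s i j] bc by simp
          qed
        qed
        moreover have "s \<in> T1 \<union> T2 \<union> T3 \<union> {e} \<or> t \<in> T1 \<union> T2 \<union> T3 \<union> {e}" if "X s t" for s t
        proof (cases "{s, t} = {{i, c}, {b, j}}")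
          case True
          then show ?thesis using e by (auto simp: doubleton_eq_iff)
        next
          case False
          then show ?thesis
            using parts[OF that False] that uncrossing_hits[OF T(1)] uncrossing_hits[OF T(2)]
              uncrossing_hits[OF T(3)] unfolding X_def by (metis Un_iff)
        qed
        ultimately show ?thesis using layout unfolding X_def by (intro uncrossingI) auto
      qed
      have split: "{i..b} \<union> {b..c} \<union> {c..j} = {i..j}" "{c..j} \<union> {b..c} \<union> {i..b} = {i..j}"
        "{i..b} \<inter> {b..c} = {b}" "{b..c} \<inter> {c..j} = {c}" "{i..b} \<inter> {c..j} = {}"
        "{c..j} \<inter> {b..c} = {c}" "{b..c} \<inter> {i..b} = {b}" "{c..j} \<inter> {i..b} = {}"
        using bc by auto
      \<comment> \<open>\<open>T1\<close> avoids \<open>i\<close> and \<open>T3\<close> avoids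
        \<open>j\<close> in both versions. The version avoiding \<open>i\<close> adds
        \<open>{b, j}\<close> and lets the middle selection \<open>T2\<close> avoid
        \<open>b\<close>; the one avoiding \<open>j\<close> adds \<open>{i, c}\<close> and lets
        \<open>T2'\<close> avoid \<open>c\<close>.\<close>
      obtain T1 where T1: "uncrossing F i b T1" "vertex_degree T1 i = 0"
          "vertex_degree T1 (Suc i) \<le> 1" "vertex_degree T1 b \<le> 1"
        using left[of i b] bc by auto
      obtain T2 where T2: "uncrossing F b c T2" "vertex_degree T2 b = 0" "vertex_degree T2 c \<le> 1"
        using left[of b c] bc by auto
      obtain T2' where T2': "uncrossing F b c T2'" "vertex_degree T2' c = 0" "vertex_degree T2' b \<le> 1"
        using right[of b c] bc by auto
      obtain T3 where T3: "uncrossing F c j T3" "vertex_degree T3 j = 0"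
          "vertex_degree T3 (j - 1) \<le> 1" "vertex_degree T3 c \<le> 1"
        using right[of c j] bc by auto
      have L: "linear_layout {i..j} (T1 \<union> T2 \<union> T3 \<union> {{b, j}})"
        using linear_layout_chain[of "{i..b}" T1 "{b..c}" T2 "{c..j}" T3 b c j]
          T1 T2 T3 bc split uncrossing_layout by auto
      \<comment> \<open>The same chain read from right to left, with \<open>c\<close>,
        \<open>b\<close>, \<open>i\<close> in the roles of \<open>b\<close>, \<open>c\<close>,
        \<open>j\<close>.\<close>
      have "linear_layout {i..j} (T3 \<union> T2' \<union> T1 \<union> {{c, i}})"
        using linear_layout_chain[of "{c..j}" T3 "{b..c}" T2' "{i..b}" T1 c b i]
          T1 T2' T3 bc split uncrossing_layout by auto
      then have L': "linear_layout {i..j} (T1 \<union> T2' \<union> T3 \<union> {{i, c}})"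
        by (simp add: insert_commute Un_ac)
      note U = join[OF T1(1) T2(1) T3(1) L] join[OF T1(1) T2'(1) T3(1) L']
      have deg0: "vertex_degree T2 i = 0" "vertex_degree T3 i = 0" "vertex_degree T1 j = 0"
          "vertex_degree T2 j = 0" "vertex_degree T2' i = 0" "vertex_degree T2' j = 0"
          "vertex_degree T3 (Suc i) = 0"
        using uncrossing_degree_0 T1(1) T2(1) T2'(1) T3(1) bc by auto
      have "j - 1 \<notin> {i..b}" using bc by auto
      then have deg0': "vertex_degree T1 (j - 1) = 0" by (rule uncrossing_degree_0[OF T1(1)])
      have edge: "vertex_degree {e} v \<le> (if v \<in> e then 1 else 0)" for e :: "nat set" and v
        using vertex_degree_insert_le[of e "{}" v] by (auto simp: vertex_degree_def)
      \<comment> \<open>The critical case is \<open>b = Suc i\<close>, where the new chord itself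
        ends at the neighbour of \<open>i\<close>. Then \<open>T1\<close> is empty and
        \<open>T2\<close> avoids \<open>b\<close>, so the degree there is still at most 1.\<close>
      have succ: "vertex_degree (T1 \<union> {{b, j}}) (Suc i) \<le> 1 \<and> vertex_degree T2 (Suc i) = 0"
      proof (cases "b = Suc i")
        case True
        then have "T1 = {}" using T1(1) uncrossing_short by blast
        then show ?thesis using True T2(2) edge[of "{b, j}" b] by simp
      next
        case False
        then show ?thesis
          using T1(3) uncrossing_degree_0[OF T2(1), of "Suc i"] bc
            un[of T1 "Suc i" 1 "{{b, j}}" 0] edge[of "{b, j}" "Suc i"] by auto
      qed
      have pred: "vertex_degree (T3 \<union> {{i, c}}) (j - 1) \<le> 1 \<and> vertex_degree T2' (j - 1) = 0"
      proof (cases "c = j - 1")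
        case True
        then have "j = Suc c" using bc by auto
        then have "T3 = {}" using T3(1) uncrossing_short by blast
        then show ?thesis using True T2'(2) edge[of "{i, c}" c] by simp
      next
        case False
        then have "j - 1 \<notin> {b..c}" "j - 1 \<notin> {i, c}" using bc by auto
        then show ?thesis
          using T3(3) uncrossing_degree_0[OF T2'(1), of "j - 1"]
            un[of T3 "j - 1" 1 "{{i, c}}" 0] edge[of "{i, c}" "j - 1"] by presburger
      qed
      have four: "vertex_degree (T1 \<union> T2 \<union> T3 \<union> {e}) v
          \<le> vertex_degree T1 v + vertex_degree T2 v + vertex_degree T3 v + vertex_degree {e} v"
        for T1 T2 T3 :: "nat set set" and e v
        using vertex_degree_Un_le[of "T1 \<union> T2 \<union> T3" "{e}" v] vertex_degree_Un_le[of "T1 \<union> T2" T3 v]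
          vertex_degree_Un_le[of T1 T2 v] by linarith
      let ?T = "T1 \<union> T2 \<union> T3 \<union> {{b, j}}" and ?T' = "T1 \<union> T2' \<union> T3 \<union> {{i, c}}"
      have "?T = (T1 \<union> {{b, j}}) \<union> (T2 \<union> T3)" "?T' = (T3 \<union> {{i, c}}) \<union> (T2' \<union> T1)" by auto
      then have "vertex_degree ?T (Suc i) \<le> 1" "vertex_degree ?T' (j - 1) \<le> 1"
        using un[of "T1 \<union> {{b, j}}" "Suc i" 1 "T2 \<union> T3" 0] un[of T2 "Suc i" 0 T3 0] succ
          un[of "T3 \<union> {{i, c}}" "j - 1" 1 "T2' \<union> T1" 0] un[of T2' "j - 1" 0 T1 0] pred deg0 deg0'
        by auto
      moreover have "vertex_degree ?T i = 0" "vertex_degree ?T j \<le> 1"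
        using four[of T1 T2 T3 "{b, j}" i] four[of T1 T2 T3 "{b, j}" j]
          edge[of "{b, j}" i] edge[of "{b, j}" j] deg0 T1 T3 bc by auto
      moreover have "vertex_degree ?T' j = 0" "vertex_degree ?T' i \<le> 1"
        using four[of T1 T2' T3 "{i, c}" i] four[of T1 T2' T3 "{i, c}" j]
          edge[of "{i, c}" i] edge[of "{i, c}" j] deg0 T1 T3 bc by auto
      ultimately show ?thesis using U by blast
    qed
  qed
qed

section \<open>Interleaved arcs in a disk meet\<close>


text \<open>In the square circumscribed about the disk, one path runs from the left side to the
  right and the other from the bottom to the top, so the Fashoda meet theorem \<open>fashoda\<close>
  applies after identifying the plane with \<open>real^2\<close>.\<close>

lemma paths_across_disk_meet:
  fixes c :: complex and R :: real
  assumes "path f" "path g" "path_image f \<subseteq> cball c R" "path_image g \<subseteq> cball c R"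
    and "pathstart f = c - of_real R" "pathfinish f = c + of_real R"
    and "pathstart g = c - \<i> * of_real R" "pathfinish g = c + \<i> * of_real R"
  obtains z where "z \<in> path_image f" "z \<in> path_image g"
proof -
  define h :: "complex \<Rightarrow> real^2" where "h z = (\<chi> i. if i = 1 then Re z else Im z)" for z
  have h: "h z $ 1 = Re z" "h z $ 2 = Im z" for z by (simp_all add: h_def)
  have inj: "h w = h z \<Longrightarrow> w = z" for w z by (metis h complex_eqI)
  have "continuous_on S (\<lambda>z. if i = 1 then Re z else Im z)" for S and i :: 2
    by (cases "i = 1") (auto intro!: continuous_intros)
  then have cont: "continuous_on S h" for S
    unfolding h_def by (rule continuous_on_vec_lambda)
  have box: "h z \<in> cbox (h (Complex (Re c - R) (Im c - R))) (h (Complex (Re c + R) (Im c + R)))"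
    if "z \<in> cball c R" for z
  proof -
    have "cmod (z - c) \<le> R" using that by (simp add: dist_norm norm_minus_commute)
    then have "\<bar>Re (z - c)\<bar> \<le> R" "\<bar>Im (z - c)\<bar> \<le> R"
      using abs_Re_le_cmod abs_Im_le_cmod order_trans by blast+
    then show ?thesis by (auto simp: mem_box_cart forall_2 h)
  qed
  have fh: "path (h \<circ> f)" by (rule path_continuous_image[OF assms(1) cont])
  have gh: "path (h \<circ> g)" by (rule path_continuous_image[OF assms(2) cont])
  obtain w where "w \<in> path_image (h \<circ> f)" "w \<in> path_image (h \<circ> g)"
  proof (rule fashoda[OF fh gh])
    show "path_image (h \<circ> f) \<subseteq> cbox (h (Complex (Re c - R) (Im c - R))) (h (Complex (Re c + R) (Im c + R)))"
      "path_image (h \<circ> g) \<subseteq> cbox (h (Complex (Re c - R) (Im c - R))) (h (Complex (Re c + R) (Im c + R)))"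
      using box assms(3,4) unfolding path_image_compose by blast+
  qed (use assms(5-8) in \<open>simp_all add: pathstart_compose pathfinish_compose h\<close>)
  then show ?thesis using that inj unfolding path_image_compose by blast
qed

lemma cis_neq_of_less:
  assumes "a < b" "b < a + 2 * pi"
  shows "cis a \<noteq> cis b"
proof
  assume "cis a = cis b"
  then have "cis (b - a) = 1" by (simp flip: cis_divide)
  moreover define d where "d = (b - a) / 2"
  then have "b - a = 2 * d" by simp
  ultimately have "cis (2 * d) = 1" by simp
  then have "cos (2 * d) = 1" by (metis Re_complex_of_real cis.sel(1) of_real_1)
  then have "sin d = 0" unfolding cos_double_sin by simp
  moreover have "0 < sin d" using assms by (intro sin_gt_zero) (auto simp: d_def)
  ultimately show False by simp
qed

text \<open>Spiralling outwards from the circle to the circle of twice the radius moves the four ends to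
  the axes without creating new intersections.\<close>

lemma interleaved_arcs_meet:
  fixes c :: complex and r :: real
  assumes "0 < r" "path g" "path h" "path_image g \<subseteq> cball c r" "path_image h \<subseteq> cball c r"
    and g: "pathstart g = c + of_real r * cis t1" "pathfinish g = c + of_real r * cis t3"
    and h: "pathstart h = c + of_real r * cis t2" "pathfinish h = c + of_real r * cis t4"
    and t: "t4 < t3" "t3 < t2" "t2 < t1" "t1 < t4 + 2 * pi"
  shows "path_image g \<inter> path_image h \<noteq> {}"
proof -
  \<comment> \<open>The spiral starts on the given circle at angle \<theta> and ends on the doubled
    circle at angle \<phi>; radius and angle both change linearly in \<open>s\<close>.\<close>
  define \<sigma> where "\<sigma> \<theta> \<phi> s = c + of_real (r * (1 + s)) * cis ((1 - s) * \<theta> + s * \<phi>)" for \<theta> \<phi> s :: real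
  have path: "path (\<sigma> \<theta> \<phi>)" for \<theta> \<phi>
    unfolding path_def \<sigma>_def cis_conv_exp by (intro continuous_intros)
  have ends: "pathstart (\<sigma> \<theta> \<phi>) = c + of_real r * cis \<theta>" "pathfinish (\<sigma> \<theta> \<phi>) = c + of_real (2 * r) * cis \<phi>" for \<theta> \<phi>
    by (simp_all add: pathstart_def pathfinish_def \<sigma>_def)
  have norm: "cmod (\<sigma> \<theta> \<phi> s - c) = r * (1 + s)" if "0 \<le> s" for \<theta> \<phi> s
    using that assms(1) by (simp add: \<sigma>_def norm_mult del: of_real_mult of_real_add)
  have big: "path_image (\<sigma> \<theta> \<phi>) \<subseteq> cball c (2 * r)" for \<theta> \<phi>
  proof
    fix z assume "z \<in> path_image (\<sigma> \<theta> \<phi>)"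
    then obtain s where "0 \<le> s" "s \<le> 1" "z = \<sigma> \<theta> \<phi> s" by (auto simp: path_image_def)
    then have "cmod (z - c) \<le> r * 2" using norm assms(1) by simp
    then show "z \<in> cball c (2 * r)" by (simp add: dist_norm norm_minus_commute)
  qed
  have apart: "path_image (\<sigma> \<theta> \<phi>) \<inter> path_image (\<sigma> \<theta>' \<phi>') = {}"
    if "\<theta> < \<theta>'" "\<theta>' < \<theta> + 2 * pi" "\<phi> < \<phi>'" "\<phi>' < \<phi> + 2 * pi" for \<theta> \<theta>' \<phi> \<phi>'
  proof (rule ccontr)
    assume "path_image (\<sigma> \<theta> \<phi>) \<inter> path_image (\<sigma> \<theta>' \<phi>') \<noteq> {}"
    then obtain s s' where "s \<in> {0..1}" "s' \<in> {0..1}" and eq: "\<sigma> \<theta> \<phi> s = \<sigma> \<theta>' \<phi>' s'"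
      unfolding path_image_def by blast
    then have s: "0 \<le> s" "s \<le> 1" "0 \<le> s'" "s' \<le> 1" by auto
    have "r * (1 + s) = r * (1 + s')"
      using norm[OF s(1), of \<theta> \<phi>] norm[OF s(3), of \<theta>' \<phi>'] eq by metis
    then have "s' = s" using assms(1) by simp
    have "of_real (r * (1 + s)) \<noteq> (0 :: complex)" using assms(1) s(1)
      by (metis add_pos_nonneg less_numeral_extra(1,3) mult_pos_pos of_real_eq_0_iff)
    then have "cis ((1 - s) * \<theta> + s * \<phi>) = cis ((1 - s) * \<theta>' + s * \<phi>')"
      using eq unfolding \<sigma>_def \<open>s' = s\<close> by (metis add_left_cancel mult_left_cancel)
    moreover have "(1 - s) * \<theta> + s * \<phi> < (1 - s) * \<theta>' + s * \<phi>'"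
    proof (cases "s = 0")
      case False
      then show ?thesis using that s by (intro add_le_less_mono mult_left_mono mult_strict_left_mono) auto
    qed (use that in simp)
    moreover have "(1 - s) * \<theta>' + s * \<phi>' < (1 - s) * (\<theta> + 2 * pi) + s * (\<phi> + 2 * pi)"
    proof (cases "s = 0")
      case False
      then show ?thesis using that s by (intro add_le_less_mono mult_left_mono mult_strict_left_mono) auto
    qed (use that in simp)
    then have "(1 - s) * \<theta>' + s * \<phi>' < (1 - s) * \<theta> + s * \<phi> + 2 * pi"
      by (simp add: algebra_simps)
    ultimately show False using cis_neq_of_less by blast
  qed
  have inner: "z = c + of_real r * cis \<theta>" if zs: "z \<in> path_image (\<sigma> \<theta> \<phi>)" "z \<in> cball c r" for z \<theta> \<phi>
  proof -
    obtain s where "s \<in> {0..1}" and z: "z = \<sigma> \<theta> \<phi> s"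
      using zs(1) unfolding path_image_def by blast
    then have s: "0 \<le> s" "z = \<sigma> \<theta> \<phi> s" by auto
    have "r * (1 + s) \<le> r" using norm[OF s(1), of \<theta> \<phi>] zs(2) s(2) by (simp add: dist_norm norm_minus_commute)
    then have "s = 0" using s(1) assms(1) by (simp add: algebra_simps mult_le_0_iff)
    then show ?thesis using s(2) by (simp add: \<sigma>_def)
  qed
  \<comment> \<open>\<open>G\<close> prolongs \<open>g\<close> to a path from the left to the right
    of the doubled disk, and \<open>H\<close> prolongs the reverse of \<open>h\<close> to one from
    bottom to top. The target angles of \<open>t1\<close>, \<open>t2\<close>, \<open>t3\<close>,
    \<open>t4\<close> are \<open>pi\<close>, \<open>pi / 2\<close>, \<open>0\<close>,
    \<open>- (pi / 2)\<close>, in the same decreasing order.\<close>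
  define G where "G = reversepath (\<sigma> t1 pi) +++ g +++ \<sigma> t3 0"
  define H where "H = reversepath (\<sigma> t4 (- (pi / 2))) +++ reversepath h +++ \<sigma> t2 (pi / 2)"
  have G: "path_image G = path_image (\<sigma> t1 pi) \<union> path_image g \<union> path_image (\<sigma> t3 0)"
    unfolding G_def using g ends by (simp add: path_image_join Un_assoc)
  have H: "path_image H = path_image (\<sigma> t4 (- (pi / 2))) \<union> path_image h \<union> path_image (\<sigma> t2 (pi / 2))"
    unfolding H_def using h ends by (simp add: path_image_join Un_assoc)
  have "path G" unfolding G_def using path g ends assms(2) by (intro path_join_imp) auto
  moreover have "path H" unfolding H_def using path h ends assms(3) by (intro path_join_imp) auto
  moreover have "cball c r \<subseteq> cball c (2 * r)" using assms(1) by (intro subset_cball) auto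
  then have "path_image G \<subseteq> cball c (2 * r)" "path_image H \<subseteq> cball c (2 * r)"
    unfolding G H using big assms(4,5) by (meson Un_least order_trans)+
  moreover have "pathstart G = c - of_real (2 * r)" "pathfinish G = c + of_real (2 * r)"
    unfolding G_def by (simp_all add: ends)
  moreover have "cis (- (pi / 2)) = - \<i>" by (simp add: complex_eq_iff)
  then have "pathstart H = c - \<i> * of_real (2 * r)" "pathfinish H = c + \<i> * of_real (2 * r)"
    unfolding H_def by (simp_all add: ends mult_ac)
  ultimately obtain z where z: "z \<in> path_image G" "z \<in> path_image H"
    using paths_across_disk_meet[of G H c "2 * r"] by blast
  have gh_ends: "c + of_real r * cis t1 \<in> path_image g" "c + of_real r * cis t3 \<in> path_image g"
      "c + of_real r * cis t2 \<in> path_image h" "c + of_real r * cis t4 \<in> path_image h"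
    using g h pathstart_in_path_image pathfinish_in_path_image by metis+
  have no: "path_image (\<sigma> t2 (pi / 2)) \<inter> path_image (\<sigma> t1 pi) = {}"
      "path_image (\<sigma> t4 (- (pi / 2))) \<inter> path_image (\<sigma> t1 pi) = {}"
      "path_image (\<sigma> t3 0) \<inter> path_image (\<sigma> t2 (pi / 2)) = {}"
      "path_image (\<sigma> t4 (- (pi / 2))) \<inter> path_image (\<sigma> t3 0) = {}"
    using t pi_gt_zero by (intro apart; linarith)+
  \<comment> \<open>Spirals of different curves are disjoint, so the meeting point lies on
    \<open>g\<close> or on \<open>h\<close>. It is then in the small disk; if it also lies on a
    spiral of the other curve, it is the start of that spiral and so an end of that curve.\<close>
  have "z \<in> path_image g \<or> z \<in> path_image h" using z no unfolding G H by blast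
  then show ?thesis
  proof
    assume zg: "z \<in> path_image g"
    then have "z \<in> path_image h" using z(2) inner gh_ends assms(4) unfolding H by (metis UnE subsetD)
    then show ?thesis using zg by blast
  next
    assume zh: "z \<in> path_image h"
    then have "z \<in> path_image g" using z(1) inner gh_ends assms(5) unfolding G by (metis UnE subsetD)
    then show ?thesis using zh by blast
  qed
qed

text \<open>Along the segment \<open>L\<close> interpolates linearly between its end values. An
  inner zero therefore forces opposite signs at the ends, and solving for the parameter locates it;
  the explicit formula later gives uniqueness of the crossing point.\<close>

lemma zero_set_meets_segment:
  fixes L :: "complex \<Rightarrow> real"
  assumes affine: "\<And>u w z. L ((1 - u) *\<^sub>R w + u *\<^sub>R z) = (1 - u) * L w + u * L z"
    and "L z = 0" "z \<in> closed_segment k l" "z \<noteq> k" "z \<noteq> l" "\<not> (L k = 0 \<and> L l = 0)"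
  shows "L k * L l < 0" "z = (1 - L k / (L k - L l)) *\<^sub>R k + (L k / (L k - L l)) *\<^sub>R l"
proof -
  obtain u where u: "0 \<le> u" "u \<le> 1" "z = (1 - u) *\<^sub>R k + u *\<^sub>R l"
    using assms(3) by (auto simp: in_segment)
  have "0 < u" "u < 1" using u assms(4,5) by (auto simp: less_le)
  have eq: "(1 - u) * L k + u * L l = 0" using affine[of u k l] u(3) assms(2) by simp
  have "L k \<noteq> 0"
    using eq \<open>0 < u\<close> assms(6) by auto
  have "u * (L k * L l) = L k * (u * L l)" by simp
  also have "\<dots> = L k * (- ((1 - u) * L k))" using eq by (simp add: add_eq_0_iff)
  also have "\<dots> = - ((1 - u) * (L k)\<^sup>2)" by (simp add: power2_eq_square)
  also have "\<dots> < 0" using \<open>u < 1\<close> \<open>L k \<noteq> 0\<close> by simp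
  finally show neg: "L k * L l < 0" using \<open>0 < u\<close> by (simp add: mult_less_0_iff)
  then have "L k - L l \<noteq> 0" by (auto simp: mult_less_0_iff)
  moreover have "L k = u * (L k - L l)" using eq by (simp add: algebra_simps)
  ultimately have "u = L k / (L k - L l)" by (simp add: field_simps)
  then show "z = (1 - L k / (L k - L l)) *\<^sub>R k + (L k / (L k - L l)) *\<^sub>R l" using u(3) by simp
qed

text \<open>Affine function vanishing exactly on the line through the points with angles \<open>\<alpha>\<close> and
  \<open>\<beta>\<close> of the circle.\<close>

definition chord_side :: "complex \<Rightarrow> real \<Rightarrow> real \<Rightarrow> real \<Rightarrow> complex \<Rightarrow> real" where
  "chord_side c r \<alpha> \<beta> z = (z - c) \<bullet> cis ((\<alpha> + \<beta>) / 2) - r * cos ((\<alpha> - \<beta>) / 2)"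

lemma chord_side_affine:
  "chord_side c r \<alpha> \<beta> ((1 - u) *\<^sub>R w + u *\<^sub>R z) =
    (1 - u) * chord_side c r \<alpha> \<beta> w + u * chord_side c r \<alpha> \<beta> z"
  unfolding chord_side_def by (simp add: inner_diff_left inner_add_left algebra_simps)

text \<open>With \<open>m\<close> the mean and \<open>d\<close> half the difference of the two
  angles, the value is \<open>r * (cos (t - m) - cos d)\<close>. The product form shows the sign,
  with one factor for each end of the chord.\<close>

lemma chord_side_circle:
  "chord_side c r \<alpha> \<beta> (c + of_real r * cis t) = - 2 * r * sin ((t - \<beta>) / 2) * sin ((t - \<alpha>) / 2)"
proof -
  define m d where "m = (\<alpha> + \<beta>) / 2" and "d = (\<alpha> - \<beta>) / 2"
  have "chord_side c r \<alpha> \<beta> (c + of_real r * cis t) = r * (cos (t - m) - cos d)"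
    unfolding chord_side_def m_def[symmetric] d_def[symmetric]
    by (simp add: inner_complex_def cos_diff right_diff_distrib distrib_left)
  also have "cos (t - m) - cos d = 2 * sin ((t - m + d) / 2) * sin ((d - (t - m)) / 2)"
    by (rule cos_diff_cos)
  also have "t - m + d = t - \<beta>" unfolding m_def d_def by (simp add: field_simps)
  also have "d - (t - m) = - (t - \<alpha>)" unfolding m_def d_def by (simp add: field_simps)
  finally show ?thesis unfolding minus_divide_left[symmetric] sin_minus by algebra
qed

lemma closed_segment_chord_side:
  assumes "z \<in> closed_segment (c + of_real r * cis \<alpha>) (c + of_real r * cis \<beta>)"
  shows "chord_side c r \<alpha> \<beta> z = 0"
proof -
  obtain u where "z = (1 - u) *\<^sub>R (c + of_real r * cis \<alpha>) + u *\<^sub>R (c + of_real r * cis \<beta>)"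
    using assms unfolding in_segment by blast
  then show ?thesis by (simp only: chord_side_affine chord_side_circle) simp
qed

section \<open>Crossings of a minimal drawing\<close>


definition list_interleaved :: "'a list \<Rightarrow> 'a set \<Rightarrow> 'a set \<Rightarrow> bool" where
  "list_interleaved vs e f \<longleftrightarrow> (\<exists>s t. s \<subseteq> {..<length vs} \<and> t \<subseteq> {..<length vs} \<and>
     interleaved s t \<and> e = (!) vs ` s \<and> f = (!) vs ` t)"

lemma list_interleaved_sym: "list_interleaved vs e f \<Longrightarrow> list_interleaved vs f e"
  unfolding list_interleaved_def using interleaved_sym by blast

lemma edge_as_indices:
  assumes "simple_graph V E" "set vs = V" "distinct vs" "e \<in> E"
  obtains p q where "p < q" "q < length vs" "e = {vs ! p, vs ! q}" "vs ! p \<noteq> vs ! q"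
proof -
  have "card e = 2" "e \<subseteq> set vs" using assms unfolding simple_graph_def by auto
  then obtain u v where uv: "e = {u, v}" "u \<noteq> v" by (meson card_2_iff)
  then obtain i k where ik: "i < length vs" "k < length vs" "u = vs ! i" "v = vs ! k"
    using \<open>e \<subseteq> set vs\<close> by (auto simp: in_set_conv_nth)
  then have "i \<noteq> k" using uv by auto
  then consider "i < k" | "k < i" by linarith
  then show ?thesis
  proof cases
    case 1
    then show ?thesis using that[of i k] uv ik by simp
  next
    case 2
    then show ?thesis using that[of k i] uv ik by (simp add: insert_commute)
  qed
qed

lemma list_interleaved_disjoint:
  assumes "distinct vs" "list_interleaved vs e f"
  shows "e \<inter> f = {}"
proof -
  obtain s t where st: "s \<subseteq> {..<length vs}" "t \<subseteq> {..<length vs}" "interleaved s t"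
      "e = (!) vs ` s" "f = (!) vs ` t"
    using assms(2) unfolding list_interleaved_def by blast
  have "s \<inter> t = {}" using st(3) unfolding interleaved_def by auto
  moreover have "inj_on ((!) vs) {..<length vs}" using assms(1) by (simp add: inj_on_nth)
  ultimately show ?thesis using st by (metis image_empty inj_on_image_Int)
qed

text \<open>Half-differences of the angles lie strictly between \<open>- pi\<close> and
  \<open>pi\<close>, so each sine has the sign of its argument. The sign of the product thus tells
  on which of the two arcs cut off by the chord a vertex lies.\<close>

lemma chord_side_sign:
  fixes c :: complex and r :: real and p q n k :: nat and \<theta> :: "nat \<Rightarrow> real"
  assumes "0 < r" "p < q" "q < n" "k < n"
    and dec: "\<And>i j. i < j \<Longrightarrow> j < n \<Longrightarrow> \<theta> j < \<theta> i \<and> \<theta> i < \<theta> j + 2 * pi"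
  defines "L \<equiv> chord_side c r (\<theta> p) (\<theta> q) (c + of_real r * cis (\<theta> k))"
  shows "p < k \<Longrightarrow> k < q \<Longrightarrow> 0 < L" "k < p \<or> q < k \<Longrightarrow> L < 0" "k = p \<or> k = q \<Longrightarrow> L = 0"
proof -
  have L: "L = - 2 * r * sin ((\<theta> k - \<theta> q) / 2) * sin ((\<theta> k - \<theta> p) / 2)"
    unfolding L_def by (rule chord_side_circle)
  have pos: "0 < sin ((\<theta> i - \<theta> j) / 2)" if "i < j" "j < n" for i j
    using dec[OF that] by (intro sin_gt_zero) auto
  have neg: "sin ((\<theta> j - \<theta> i) / 2) < 0" if "i < j" "j < n" for i j
  proof -
    have "(\<theta> j - \<theta> i) / 2 = - ((\<theta> i - \<theta> j) / 2)" by (simp add: field_simps)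
    then show ?thesis using pos[OF that] by (metis neg_less_0_iff_less sin_minus)
  qed
  show "0 < L" if "p < k" "k < q"
    using pos[OF that(2)] neg[OF that(1)] assms(1-4) unfolding L
    by (simp add: mult_less_0_iff zero_less_mult_iff)
  show "L < 0" if "k < p \<or> q < k"
    using that
  proof
    assume "k < p"
    then show ?thesis using pos[of k p] pos[of k q] assms(1-4) unfolding L
      by (simp add: mult_less_0_iff zero_less_mult_iff)
  next
    assume "q < k"
    then show ?thesis using neg[of p k] neg[of q k] assms(1-4) unfolding L
      by (simp add: mult_less_0_iff zero_less_mult_iff)
  qed
  show "L = 0" if "k = p \<or> k = q"
    using that unfolding L by auto
qed

text \<open>An edge is an unordered pair and does not fix a direction for its segment, hence the
  choice; the path image does not depend on it. Vertices stay in place, so their clockwise order is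
  kept.\<close>

definition straight_drawing :: "'a drawing \<Rightarrow> 'a drawing" where
  "straight_drawing D = D\<lparr>edge_curve := \<lambda>e. SOME \<gamma>. \<exists>u v. e = {u, v} \<and>
     \<gamma> = linepath (vertex_point D u) (vertex_point D v)\<rparr>"

lemma straight_drawing_simps [simp]:
  "disk_center (straight_drawing D) = disk_center D"
  "disk_radius (straight_drawing D) = disk_radius D"
  "vertex_point (straight_drawing D) = vertex_point D"
  by (simp_all add: straight_drawing_def)

lemma straight_drawing_edge:
  obtains u' v' where "{u, v} = {u', v'}"
    "edge_curve (straight_drawing D) {u, v} = linepath (vertex_point D u') (vertex_point D v')"
proof -
  have "\<exists>\<gamma> u' v'. {u, v} = {u', v'} \<and> \<gamma> = linepath (vertex_point D u') (vertex_point D v')" by blast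
  from someI_ex[OF this] show ?thesis
    using that unfolding straight_drawing_def by auto
qed

lemma straight_drawing_path_image:
  "path_image (edge_curve (straight_drawing D) {u, v}) = closed_segment (vertex_point D u) (vertex_point D v)"
proof -
  obtain u' v' where uv: "{u, v} = {u', v'}"
      "edge_curve (straight_drawing D) {u, v} = linepath (vertex_point D u') (vertex_point D v')"
    using straight_drawing_edge[of u v D] by blast
  then have "u = u' \<and> v = v' \<or> u = v' \<and> v = u'" by (simp add: doubleton_eq_iff)
  then show ?thesis unfolding uv(2) by (auto simp: closed_segment_commute)
qed

text \<open>The line through \<open>e\<close> is the zero set of an affine function
  \<open>L\<close>. The inner part of \<open>f\<close> can meet it only if the ends of
  \<open>f\<close> have opposite signs, that is, lie on different arcs cut off by \<open>e\<close>,
  and then in one point only.\<close>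

lemma straight_drawing_crossing:
  assumes "simple_graph V E" "0 < disk_radius D" "clockwise_order V D vs"
    and "e \<in> E" "f \<in> E" "e \<noteq> f"
  shows "crossing_points (straight_drawing D) e f \<noteq> {} \<Longrightarrow> list_interleaved vs e f"
    and "\<exists>w. crossing_points (straight_drawing D) e f \<subseteq> {w}"
proof -
  let ?n = "length vs"
  let ?v = "vertex_point D"
  obtain \<theta> where vs: "distinct vs" "set vs = V"
    and pt: "\<And>i. i < ?n \<Longrightarrow> ?v (vs ! i) = disk_center D + complex_of_real (disk_radius D) * cis (\<theta> i)"
    and dec: "\<And>i j. i < j \<Longrightarrow> j < ?n \<Longrightarrow> \<theta> j < \<theta> i \<and> \<theta> i < \<theta> j + 2 * pi"
    using assms(3) unfolding clockwise_order_def by blast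
  obtain p q where pq: "p < q" "q < ?n" "e = {vs ! p, vs ! q}"
    using edge_as_indices[OF assms(1) vs(2,1) assms(4)] by metis
  obtain k l where kl: "k < l" "l < ?n" "f = {vs ! k, vs ! l}"
    using edge_as_indices[OF assms(1) vs(2,1) assms(5)] by metis
  define L where "L = chord_side (disk_center D) (disk_radius D) (\<theta> p) (\<theta> q)"
  have sgn: "p < i \<Longrightarrow> i < q \<Longrightarrow> 0 < L (?v (vs ! i))" "i < p \<or> q < i \<Longrightarrow> L (?v (vs ! i)) < 0"
      "i = p \<or> i = q \<Longrightarrow> L (?v (vs ! i)) = 0" if "i < ?n" for i
    unfolding L_def pt[OF that] by (rule chord_side_sign[OF assms(2) pq(1,2) that dec]; assumption)+
  have nz: "L (?v (vs ! i)) = 0 \<Longrightarrow> i = p \<or> i = q" if "i < ?n" for i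
    using sgn(1,2)[OF that] by (metis less_irrefl linorder_neqE_nat)
  have "k < ?n" using kl by simp
  have "\<not> (L (?v (vs ! k)) = 0 \<and> L (?v (vs ! l)) = 0)"
  proof
    assume "L (?v (vs ! k)) = 0 \<and> L (?v (vs ! l)) = 0"
    then have "(k = p \<or> k = q) \<and> (l = p \<or> l = q)" using nz \<open>k < ?n\<close> kl(2) by blast
    then show False using kl pq assms(6) by auto
  qed
  moreover have "L z = 0 \<and> z \<in> closed_segment (?v (vs ! k)) (?v (vs ! l)) \<and> z \<noteq> ?v (vs ! k) \<and> z \<noteq> ?v (vs ! l)"
    if "z \<in> crossing_points (straight_drawing D) e f" for z
  proof -
    have "z \<in> closed_segment (?v (vs ! p)) (?v (vs ! q))"
      using that unfolding crossing_points_def edge_interior_def pq(3) straight_drawing_path_image by blast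
    then have "L z = 0" unfolding L_def using pt pq closed_segment_chord_side by simp
    then show ?thesis
      using that unfolding crossing_points_def edge_interior_def kl(3) straight_drawing_path_image by simp
  qed
  moreover have affine: "L ((1 - u) *\<^sub>R w + u *\<^sub>R z) = (1 - u) * L w + u * L z" for u w z
    unfolding L_def by (rule chord_side_affine)
  ultimately have
    neg: "z \<in> crossing_points (straight_drawing D) e f \<Longrightarrow> L (?v (vs ! k)) * L (?v (vs ! l)) < 0" and
    uniq: "z \<in> crossing_points (straight_drawing D) e f \<Longrightarrow>
      z = (1 - L (?v (vs ! k)) / (L (?v (vs ! k)) - L (?v (vs ! l)))) *\<^sub>R ?v (vs ! k) +
          (L (?v (vs ! k)) / (L (?v (vs ! k)) - L (?v (vs ! l)))) *\<^sub>R ?v (vs ! l)" for z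
    using zero_set_meets_segment[of L z "?v (vs ! k)" "?v (vs ! l)"] by blast+
  show "\<exists>w. crossing_points (straight_drawing D) e f \<subseteq> {w}" using uniq by blast
  assume "crossing_points (straight_drawing D) e f \<noteq> {}"
  then have "L (?v (vs ! k)) < 0 \<and> 0 < L (?v (vs ! l)) \<or> 0 < L (?v (vs ! k)) \<and> L (?v (vs ! l)) < 0"
    using neg by (auto simp: mult_less_0_iff)
  moreover have "p < i \<and> i < q" if "0 < L (?v (vs ! i))" "i < ?n" for i
    using sgn[OF that(2)] that(1) by (metis less_irrefl less_trans linorder_neqE_nat)
  moreover have "i < p \<or> q < i" if "L (?v (vs ! i)) < 0" "i < ?n" for i
    using sgn[OF that(2)] that(1) by (metis less_irrefl less_trans linorder_neqE_nat)
  ultimately have "(k < p \<or> q < k) \<and> p < l \<and> l < q \<or> p < k \<and> k < q \<and> (l < p \<or> q < l)"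
    using \<open>k < ?n\<close> kl(2) by blast
  then have "interleaved {p, q} {k, l}"
    unfolding interleaved_pairs[OF pq(1) kl(1)] using pq(1) kl(1) by linarith
  moreover have "{p, q} \<subseteq> {..<?n}" "{k, l} \<subseteq> {..<?n}" "e = (!) vs ` {p, q}" "f = (!) vs ` {k, l}"
    using pq kl by auto
  ultimately show "list_interleaved vs e f" unfolding list_interleaved_def by blast
qed

text \<open>The main point is that no edge passes through a further vertex:
  \<open>chord_side\<close> vanishes on the chord but is nonzero at every vertex other than its
  ends.\<close>

lemma straight_drawing_disk_drawing:
  assumes "simple_graph V E" "disk_drawing V E D" "clockwise_order V D vs"
  shows "disk_drawing V E (straight_drawing D)"
proof -
  let ?n = "length vs"
  let ?v = "vertex_point D"
  let ?S = "straight_drawing D"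
  have D: "0 < disk_radius D" "inj_on ?v V" "?v ` V \<subseteq> sphere (disk_center D) (disk_radius D)"
    using assms(2) unfolding disk_drawing_def by blast+
  obtain \<theta> where vs: "distinct vs" "set vs = V"
    and pt: "\<And>i. i < ?n \<Longrightarrow> ?v (vs ! i) = disk_center D + complex_of_real (disk_radius D) * cis (\<theta> i)"
    and dec: "\<And>i j. i < j \<Longrightarrow> j < ?n \<Longrightarrow> \<theta> j < \<theta> i \<and> \<theta> i < \<theta> j + 2 * pi"
    using assms(3) unfolding clockwise_order_def by blast
  have edge: "arc (edge_curve ?S e)"
      "{pathstart (edge_curve ?S e), pathfinish (edge_curve ?S e)} = ?v ` e"
      "path_image (edge_curve ?S e) \<subseteq> cball (disk_center D) (disk_radius D)"
      "edge_interior ?S e \<inter> ?v ` V = {}" if e: "e \<in> E" for e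
  proof -
    obtain p q where pq: "p < q" "q < ?n" "e = {vs ! p, vs ! q}" "vs ! p \<noteq> vs ! q"
      using edge_as_indices[OF assms(1) vs(2,1) e] by metis
    obtain u v where uv: "{vs ! p, vs ! q} = {u, v}" "edge_curve ?S e = linepath (?v u) (?v v)"
      unfolding pq(3) using straight_drawing_edge[of "vs ! p" "vs ! q" D] by blast
    have inV: "vs ! p \<in> V" "vs ! q \<in> V" using vs pq by auto
    then have "u \<in> V" "v \<in> V" "u \<noteq> v" using uv(1) pq(4) by (auto simp: doubleton_eq_iff)
    then show "arc (edge_curve ?S e)"
      unfolding uv(2) using D(2) by (simp add: arc_linepath inj_on_eq_iff)
    have "?v ` e = {?v u, ?v v}" unfolding pq(3) uv(1) by simp
    then show "{pathstart (edge_curve ?S e), pathfinish (edge_curve ?S e)} = ?v ` e"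
      unfolding uv(2) by simp
    have "?v u \<in> cball (disk_center D) (disk_radius D)" "?v v \<in> cball (disk_center D) (disk_radius D)"
      using D(3) \<open>u \<in> V\<close> \<open>v \<in> V\<close> sphere_cball by blast+
    then show "path_image (edge_curve ?S e) \<subseteq> cball (disk_center D) (disk_radius D)"
      unfolding uv(2) path_image_linepath by (intro closed_segment_subset) auto
    show "edge_interior ?S e \<inter> ?v ` V = {}"
    proof (rule ccontr)
      assume "edge_interior ?S e \<inter> ?v ` V \<noteq> {}"
      then obtain x where x: "x \<in> V" "?v x \<in> edge_interior ?S e" by blast
      then obtain k where k: "k < ?n" "x = vs ! k" using vs(2) by (metis in_set_conv_nth)
      have "?v x \<in> closed_segment (?v (vs ! p)) (?v (vs ! q))" "x \<noteq> vs ! p" "x \<noteq> vs ! q"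
        using x(2) unfolding edge_interior_def pq(3) straight_drawing_path_image by auto
      then have k': "?v (vs ! k) \<in> closed_segment (?v (vs ! p)) (?v (vs ! q))" "k \<noteq> p" "k \<noteq> q"
        using k by auto
      have "p < ?n" using pq by simp
      have zero: "chord_side (disk_center D) (disk_radius D) (\<theta> p) (\<theta> q) (?v (vs ! k)) = 0"
        by (rule closed_segment_chord_side) (use k'(1) in \<open>simp only: pt[OF \<open>p < ?n\<close>] pt[OF pq(2)]\<close>)
      have sign: "p < k \<Longrightarrow> k < q \<Longrightarrow> 0 < chord_side (disk_center D) (disk_radius D) (\<theta> p) (\<theta> q) (?v (vs ! k))"
          "k < p \<or> q < k \<Longrightarrow> chord_side (disk_center D) (disk_radius D) (\<theta> p) (\<theta> q) (?v (vs ! k)) < 0"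
        unfolding pt[OF k(1)] by (rule chord_side_sign[OF D(1) pq(1,2) k(1) dec]; assumption)+
      consider "p < k" "k < q" | "k < p \<or> q < k" using k'(2,3) by linarith
      then show False using sign zero by cases auto
    qed
  qed
  have "finite (crossing_points ?S e f)" if "e \<in> E" "f \<in> E" "e \<noteq> f" for e f
    using straight_drawing_crossing(2)[OF assms(1) D(1) assms(3) that]
    by (metis finite.emptyI finite_insert finite_subset)
  then show ?thesis unfolding disk_drawing_def using D edge by simp
qed

text \<open>The two curves meet by the topological lemma. Interleaved edges have no common end and
  edges avoid all other vertices, so the common point is interior to both.\<close>

lemma interleaved_edges_cross:
  assumes "disk_drawing V E D" "clockwise_order V D vs" "e \<in> E" "f \<in> E" "list_interleaved vs e f"
  shows "crosses D e f"
proof -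
  let ?n = "length vs"
  let ?v = "vertex_point D"
  obtain \<theta> where vs: "distinct vs" "set vs = V"
    and pt: "\<And>i. i < ?n \<Longrightarrow> ?v (vs ! i) = disk_center D + complex_of_real (disk_radius D) * cis (\<theta> i)"
    and dec: "\<And>i j. i < j \<Longrightarrow> j < ?n \<Longrightarrow> \<theta> j < \<theta> i \<and> \<theta> i < \<theta> j + 2 * pi"
    using assms(2) unfolding clockwise_order_def by blast
  have D: "0 < disk_radius D" "inj_on ?v V" 
      "\<And>e. e \<in> E \<Longrightarrow> arc (edge_curve D e)"
      "\<And>e. e \<in> E \<Longrightarrow> {pathstart (edge_curve D e), pathfinish (edge_curve D e)} = ?v ` e"
      "\<And>e. e \<in> E \<Longrightarrow> path_image (edge_curve D e) \<subseteq> cball (disk_center D) (disk_radius D)"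
      "\<And>e. e \<in> E \<Longrightarrow> edge_interior D e \<inter> ?v ` V = {}"
    using assms(1) unfolding disk_drawing_def by blast+
  have oriented: "\<exists>g. path g \<and> path_image g = path_image (edge_curve D {u, v}) \<and>
      pathstart g = ?v u \<and> pathfinish g = ?v v" if "{u, v} \<in> E" for u v
  proof -
    have "{pathstart (edge_curve D {u, v}), pathfinish (edge_curve D {u, v})} = {?v u, ?v v}"
      using D(4)[OF that] by simp
    then consider "pathstart (edge_curve D {u, v}) = ?v u \<and> pathfinish (edge_curve D {u, v}) = ?v v"
      | "pathstart (edge_curve D {u, v}) = ?v v \<and> pathfinish (edge_curve D {u, v}) = ?v u"
      by (auto simp: doubleton_eq_iff)
    then show ?thesis
    proof cases
      case 1
      then show ?thesis using D(3)[OF that] arc_imp_path by blast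
    next
      case 2
      then show ?thesis using D(3)[OF that]
        by (intro exI[of _ "reversepath (edge_curve D {u, v})"]) (simp add: arc_imp_path)
    qed
  qed
  have meet: "path_image (edge_curve D {vs ! a, vs ! c}) \<inter> path_image (edge_curve D {vs ! b, vs ! d}) \<noteq> {}"
    if abcd: "a < b" "b < c" "c < d" "d < ?n" and E: "{vs ! a, vs ! c} \<in> E" "{vs ! b, vs ! d} \<in> E"
    for a b c d
  proof -
    obtain g where g: "path g" "path_image g = path_image (edge_curve D {vs ! a, vs ! c})"
        "pathstart g = ?v (vs ! a)" "pathfinish g = ?v (vs ! c)"
      using oriented[OF E(1)] by blast
    obtain h where h: "path h" "path_image h = path_image (edge_curve D {vs ! b, vs ! d})"
        "pathstart h = ?v (vs ! b)" "pathfinish h = ?v (vs ! d)"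
      using oriented[OF E(2)] by blast
    have "path_image g \<inter> path_image h \<noteq> {}"
    proof (rule interleaved_arcs_meet[OF D(1) g(1) h(1)])
      show "path_image g \<subseteq> cball (disk_center D) (disk_radius D)"
        "path_image h \<subseteq> cball (disk_center D) (disk_radius D)"
        using g(2) h(2) D(5) E by simp_all
      show "\<theta> d < \<theta> c" "\<theta> c < \<theta> b" "\<theta> b < \<theta> a" "\<theta> a < \<theta> d + 2 * pi" using dec abcd by simp_all
    qed (use g h pt abcd in simp_all)
    then show ?thesis using g(2) h(2) by simp
  qed
  obtain s t where st: "s \<subseteq> {..<?n}" "t \<subseteq> {..<?n}" "interleaved s t" "e = (!) vs ` s" "f = (!) vs ` t"
    using assms(5) unfolding list_interleaved_def by blast
  obtain a b c d where abcd: "a < b" "b < c" "c < d"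
      and "s = {a, c} \<and> t = {b, d} \<or> s = {b, d} \<and> t = {a, c}"
    using st(3) unfolding interleaved_def by blast
  moreover from this have "d < ?n" using st(1,2) by auto
  ultimately have "path_image (edge_curve D e) \<inter> path_image (edge_curve D f) \<noteq> {}"
    using meet[of a b c d] st(4,5) assms(3,4) by (auto simp: Int_commute)
  then obtain z where z: "z \<in> path_image (edge_curve D e)" "z \<in> path_image (edge_curve D f)" by blast
  have disj: "e \<inter> f = {}" using list_interleaved_disjoint[OF vs(1) assms(5)] .
  have sub: "e \<subseteq> V" "f \<subseteq> V" using st vs(2) by auto
  have "?v ` e \<inter> ?v ` f = {}" using disj sub D(2) by (metis image_empty inj_on_image_Int)
  then have "z \<notin> ?v ` e" "z \<notin> ?v ` f"
    using D(6)[OF assms(3)] D(6)[OF assms(4)] z sub unfolding edge_interior_def by blast+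
  then have "z \<in> crossing_points D e f" using z unfolding crossing_points_def edge_interior_def by blast
  moreover have "e \<noteq> f"
    using disj st(3,4) unfolding interleaved_def by auto
  ultimately show ?thesis unfolding crosses_def by blast
qed

text \<open>The straight-line drawing on the same vertices has exactly one crossing per interleaved pair,
  and every drawing has at least one there; so a drawing with fewest crossings has no others.\<close>

lemma crosses_iff_interleaved:
  assumes "simple_graph V E" "pseudo_outerplanar_diagram V E D" "clockwise_order V D vs"
    and "e \<in> E" "f \<in> E"
  shows "crosses D e f \<longleftrightarrow> list_interleaved vs e f"
proof
  let ?S = "straight_drawing D"
  let ?X = "\<lambda>D. {({e, f}, p) | e f p. e \<in> E \<and> f \<in> E \<and> e \<noteq> f \<and> p \<in> crossing_points D e f}"
  let ?I = "{{e, f} | e f. e \<in> E \<and> f \<in> E \<and> e \<noteq> f \<and> list_interleaved vs e f}"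
  have DD: "disk_drawing V E D" and one: "\<And>e. e \<in> E \<Longrightarrow> card {f \<in> E. crosses D e f} \<le> 1"
    and min: "\<And>D' :: 'a drawing. one_crossing_drawing V E D' \<Longrightarrow> number_of_crossings E D \<le> number_of_crossings E D'"
    using assms(2) unfolding pseudo_outerplanar_diagram_def one_crossing_drawing_def by blast+
  have r: "0 < disk_radius D" using DD unfolding disk_drawing_def by blast
  have "finite V" "E \<subseteq> Pow V" using assms(1) unfolding simple_graph_def by auto
  then have finE: "finite E" using finite_subset by blast
  have S: "disk_drawing V E ?S" using straight_drawing_disk_drawing[OF assms(1) DD assms(3)] .
  have S_D: "crosses ?S e f \<Longrightarrow> crosses D e f" if "e \<in> E" "f \<in> E" for e f
    using straight_drawing_crossing(1)[OF assms(1) r assms(3) that]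
      interleaved_edges_cross[OF DD assms(3) that] unfolding crosses_def by blast
  \<comment> \<open>Edges that cross in the straight-line drawing already cross in \<open>D\<close>,
    so this drawing competes in the minimality of \<open>D\<close>.\<close>
  have "one_crossing_drawing V E ?S"
    unfolding one_crossing_drawing_def
  proof (intro conjI ballI S)
    fix e assume e: "e \<in> E"
    have "card {f \<in> E. crosses ?S e f} \<le> card {f \<in> E. crosses D e f}"
      using finE S_D e by (intro card_mono) auto
    then show "card {f \<in> E. crosses ?S e f} \<le> 1" using one[OF e] by linarith
  qed
  then have le: "card (?X D) \<le> card (?X ?S)" using min unfolding number_of_crossings_def by blast
  have finI: "finite ?I" 
    by (rule finite_subset[of _ "Pow E"]) (use finE in auto)
  \<comment> \<open>Each pair has at most one crossing point here, so counting crossing points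
    amounts to counting pairs.\<close>
  have inj: "inj_on fst (?X ?S)"
  proof (rule inj_onI)
    fix a b assume ab: "a \<in> ?X ?S" "b \<in> ?X ?S" "fst a = fst b"
    obtain e f p where a: "a = ({e, f}, p)" "e \<in> E" "f \<in> E" "e \<noteq> f" "p \<in> crossing_points ?S e f"
      using ab(1) by blast
    obtain e' f' p' where b: "b = ({e', f'}, p')" "p' \<in> crossing_points ?S e' f'"
      using ab(2) by blast
    have "{e, f} = {e', f'}" using a(1) b(1) ab(3) by simp
    then have "crossing_points ?S e' f' = crossing_points ?S e f"
      by (auto simp: doubleton_eq_iff crossing_points_def)
    then have "p = p'"
      using straight_drawing_crossing(2)[OF assms(1) r assms(3) a(2-4)] a(5) b(2) by blast
    then show "a = b" using \<open>{e, f} = {e', f'}\<close> a(1) b(1) by simp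
  qed
  have "fst ` ?X ?S \<subseteq> ?I"
    using straight_drawing_crossing(1)[OF assms(1) r assms(3)] by fastforce
  then have "card (fst ` ?X ?S) \<le> card ?I" by (rule card_mono[OF finI])
  then have "card (?X ?S) \<le> card ?I" unfolding card_image[OF inj] .
  then have le': "card (?X D) \<le> card ?I" using le by linarith
  \<comment> \<open>The bound on \<open>card\<close> says something about \<open>?X D\<close> only
    if the set is finite, since an infinite set has \<open>card\<close> 0.\<close>
  have "finite (?X D)"
  proof (rule finite_subset)
    show "?X D \<subseteq> (\<Union>(e, f) \<in> {(e, f). e \<in> E \<and> f \<in> E \<and> e \<noteq> f}. {{e, f}} \<times> crossing_points D e f)" by auto
    show "finite (\<Union>(e, f) \<in> {(e, f). e \<in> E \<and> f \<in> E \<and> e \<noteq> f}. {{e, f}} \<times> crossing_points D e f)"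
    proof (rule finite_UN_I)
      show "finite {(e, f). e \<in> E \<and> f \<in> E \<and> e \<noteq> f}"
        by (rule finite_subset[of _ "E \<times> E"]) (use finE in auto)
      fix x assume "x \<in> {(e, f). e \<in> E \<and> f \<in> E \<and> e \<noteq> f}"
      then obtain e f where x: "x = (e, f)" "e \<in> E" "f \<in> E" "e \<noteq> f" by blast
      then have "finite (crossing_points D e f)" using DD unfolding disk_drawing_def by blast
      then show "finite (case x of (e, f) \<Rightarrow> {{e, f}} \<times> crossing_points D e f)" using x(1) by simp
    qed
  qed
  then have fin: "finite (fst ` ?X D)" and "card (fst ` ?X D) \<le> card (?X D)"
    by (auto intro: card_image_le)
  then have le_I: "card (fst ` ?X D) \<le> card ?I" using le' by linarith
  have sub: "?I \<subseteq> fst ` ?X D"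
  proof
    fix x assume "x \<in> ?I"
    then obtain e f where ef: "x = {e, f}" "e \<in> E" "f \<in> E" "e \<noteq> f" "list_interleaved vs e f" by blast
    then obtain p where "p \<in> crossing_points D e f"
      using interleaved_edges_cross[OF DD assms(3)] unfolding crosses_def by blast
    then have "(x, p) \<in> ?X D" using ef by blast
    then show "x \<in> fst ` ?X D" by (rule image_eqI[rotated]) simp
  qed
  \<comment> \<open>The interleaved pairs are among the crossing pairs of \<open>D\<close> and at
    least as many, so both sets agree.\<close>
  have eq: "?I = fst ` ?X D" by (rule card_seteq[OF fin sub le_I])
  assume "crosses D e f"
  then obtain p where "({e, f}, p) \<in> ?X D" using assms(4,5) unfolding crosses_def by blast
  then have "{e, f} \<in> fst ` ?X D" by (rule image_eqI[rotated]) simp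
  then have "{e, f} \<in> ?I" unfolding eq .
  then obtain e' f' where "{e, f} = {e', f'}" "list_interleaved vs e' f'"
    unfolding mem_Collect_eq by metis
  then show "list_interleaved vs e f"
    using list_interleaved_sym by (metis doubleton_eq_iff)
next
  assume "list_interleaved vs e f"
  then show "crosses D e f"
    using interleaved_edges_cross assms unfolding pseudo_outerplanar_diagram_def one_crossing_drawing_def
    by blast
qed

section \<open>Removing a linear forest\<close>


lemma clockwise_order_rotate1:
  assumes "clockwise_order V D vs"
  shows "clockwise_order V D (rotate1 vs)"
proof (cases vs)
  case Nil
  then show ?thesis using assms by simp
next
  case (Cons v ws)
  obtain \<theta> where pt: "\<And>i. i < length vs \<Longrightarrow> vertex_point D (vs ! i) =
      disk_center D + complex_of_real (disk_radius D) * cis (\<theta> i)"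
    and dec: "\<And>i j. i < j \<Longrightarrow> j < length vs \<Longrightarrow> \<theta> j < \<theta> i \<and> \<theta> i < \<theta> j + 2 * pi"
    using assms unfolding clockwise_order_def by blast
  \<comment> \<open>The old first vertex now comes last; lowering its angle by a full turn keeps the
    sequence decreasing.\<close>
  define \<theta>' where "\<theta>' i = (if i = length ws then \<theta> 0 - 2 * pi else \<theta> (Suc i))" for i
  have rot: "rotate1 vs = ws @ [v]" using Cons by simp
  have turn: "cis (t - 2 * pi) = cis t" for t by (simp add: complex_eq_iff cos_diff sin_diff)
  have "vertex_point D (rotate1 vs ! i) = disk_center D + complex_of_real (disk_radius D) * cis (\<theta>' i)"
    if "i < length (rotate1 vs)" for i
  proof (cases "i = length ws")
    case True
    then show ?thesis using pt[of 0] Cons unfolding \<theta>'_def rot by (simp add: turn)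
  next
    case False
    then have "i < length ws" using that Cons by simp
    then show ?thesis using pt[of "Suc i"] Cons False unfolding \<theta>'_def rot by (simp add: nth_append)
  qed
  moreover have "\<theta>' j < \<theta>' i \<and> \<theta>' i < \<theta>' j + 2 * pi" if "i < j" "j < length (rotate1 vs)" for i j
  proof (cases "j = length ws")
    case True
    then show ?thesis using dec[of 0 "Suc i"] that Cons unfolding \<theta>'_def by auto
  next
    case False
    then show ?thesis using dec[of "Suc i" "Suc j"] that Cons unfolding \<theta>'_def by auto
  qed
  moreover have "distinct (rotate1 vs)" "set (rotate1 vs) = V"
    using assms unfolding clockwise_order_def by simp_all
  ultimately show ?thesis unfolding clockwise_order_def by blast
qed

lemma cycle_edges_rotate1: "cycle_edges (rotate1 vs) = cycle_edges vs"
proof -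
  let ?n = "length vs"
  \<comment> \<open>Reducing the first index as well makes the edges periodic, so that shifting the
    range only trades index 0 for \<open>?n\<close>.\<close>
  let ?e = "\<lambda>i. {vs ! (i mod ?n), vs ! (Suc i mod ?n)}"
  have image: "cycle_edges ws = (\<lambda>i. {ws ! i, ws ! (Suc i mod length ws)}) ` {..<length ws}" for ws :: "'a list"
    unfolding cycle_edges_def by auto
  have 1: "cycle_edges vs = ?e ` {..<?n}"
    unfolding image by (rule image_cong) simp_all
  have 2: "cycle_edges (rotate1 vs) = (\<lambda>i. ?e (Suc i)) ` {..<?n}"
    unfolding image length_rotate1
  proof (rule image_cong)
    fix i assume "i \<in> {..<?n}"
    then have "i < ?n" "Suc i mod ?n < ?n" by (auto intro: mod_less_divisor)
    then show "{rotate1 vs ! i, rotate1 vs ! (Suc i mod ?n)} = ?e (Suc i)"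
      by (simp add: nth_rotate1 mod_Suc_eq)
  qed simp
  have "?e ?n = ?e 0" by (simp add: mod_Suc)
  show ?thesis
  proof (cases "?n = 0")
    case False
    have "Suc ` {..<?n} = {1..<?n} \<union> {?n}" using False by (auto simp: image_Suc_lessThan Suc_le_eq)
    moreover have "{..<?n} = {1..<?n} \<union> {0}" using False by auto
    ultimately have "?e ` Suc ` {..<?n} = ?e ` {..<?n}" using \<open>?e ?n = ?e 0\<close> by auto
    then show ?thesis unfolding 1 2 by (simp add: image_image)
  qed simp
qed

lemma clockwise_order_rotate:
  assumes "clockwise_order V D vs"
  shows "clockwise_order V D (rotate m vs)" "cycle_edges (rotate m vs) = cycle_edges vs"
  using assms by (induction m) (simp_all add: clockwise_order_rotate1 cycle_edges_rotate1)

lemma crossing_chords_cong: "cycle_edges vs = cycle_edges ws \<Longrightarrow>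
  crossing_chords E D vs = crossing_chords E D ws"
  unfolding crossing_chords_def chords_def by simp

lemma cycle_edges_index:
  assumes "distinct vs" "{vs ! p, vs ! q} \<in> cycle_edges vs" "p < q" "q < length vs"
  shows "q = Suc p \<or> p = 0 \<and> Suc q = length vs"
proof -
  obtain i where i: "i < length vs" "{vs ! p, vs ! q} = {vs ! i, vs ! (Suc i mod length vs)}"
    using assms(2) unfolding cycle_edges_def by blast
  have "Suc i mod length vs < length vs" using i(1) by (intro mod_less_divisor) linarith
  then have "p = i \<and> q = Suc i mod length vs \<or> q = i \<and> p = Suc i mod length vs"
    using i assms(1,3,4) by (auto simp: doubleton_eq_iff nth_eq_iff_index_eq)
  then show ?thesis using i(1) assms(3) by (auto simp: mod_Suc split: if_splits)
qed

text \<open>The other edge has one end between the two ends and one outside, so they are neither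
  consecutive nor the first and last entries. Hence interleaved edges are chords.\<close>

lemma interleaved_not_cycle_edge:
  assumes "distinct vs" "list_interleaved vs e f"
  shows "e \<notin> cycle_edges vs"
proof
  assume e: "e \<in> cycle_edges vs"
  obtain s t where st: "s \<subseteq> {..<length vs}" "t \<subseteq> {..<length vs}" "interleaved s t" "e = (!) vs ` s"
    using assms(2) unfolding list_interleaved_def by blast
  obtain a b c d where abcd: "a < b" "b < c" "c < d"
      "s = {a, c} \<and> t = {b, d} \<or> s = {b, d} \<and> t = {a, c}"
    using st(3) unfolding interleaved_def by blast
  then have "d < length vs" using st(1,2) by auto
  then show False
    using abcd st(4) e cycle_edges_index[OF assms(1), of a c] cycle_edges_index[OF assms(1), of b d]
    by auto
qed

section \<open>Transfer from indices back to vertices\<close>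

lemma vertex_degree_image:
  assumes "inj_on g A" "\<And>s. s \<in> T \<Longrightarrow> s \<subseteq> A" "v \<in> A"
  shows "vertex_degree ((`) g ` T) (g v) = vertex_degree T v"
proof -
  have "g v \<in> g ` s \<longleftrightarrow> v \<in> s" if "s \<in> T" for s
    using inj_on_image_mem_iff[OF assms(1,3) assms(2)[OF that]] .
  then have "{e \<in> (`) g ` T. g v \<in> e} = (`) g ` {s \<in> T. v \<in> s}" by auto
  moreover have "inj_on ((`) g) {s \<in> T. v \<in> s}"
    using assms(2) by (intro inj_on_subset[OF inj_on_image_Pow[OF assms(1)]]) auto
  ultimately show ?thesis unfolding vertex_degree_def by (simp add: card_image)
qed

lemma linear_layout_image:
  assumes "inj_on g S" "linear_layout S T"
  shows "linear_layout (g ` S) ((`) g ` T)"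
proof -
  obtain L where "distinct L" "set L = S" "T \<subseteq> path_edges L"
    using assms(2) unfolding linear_layout_def by blast
  then show ?thesis
    unfolding linear_layout_def using assms(1)
    by (intro exI[of _ "map g L"]) (auto simp: distinct_map path_edges_map)
qed

lemma disk_drawing_subset:
  assumes "disk_drawing V E D" "F \<subseteq> E"
  shows "disk_drawing V F D"
  using assms(1) subsetD[OF assms(2)] unfolding disk_drawing_def
  by simp

text \<open>Crossings of the minimal drawing are exactly the interleaved pairs, so the interval
  statement applies to the index pairs \<open>F\<close> of edges on the whole range. Index 0 is the
  avoided point, and 1 and \<open>length vs - 1\<close> are its neighbours on the cycle.\<close>

lemma linear_forest_removal_at_first_vertex:
  assumes "simple_graph V E" "pseudo_outerplanar_diagram V E D" "clockwise_order V D vs"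
    and "length vs \<ge> 2"
  shows "\<exists>T \<subseteq> E. linear_forest V T \<and> T \<subseteq> crossing_chords E D vs \<and>
      vertex_degree T (vs ! 0) = 0 \<and> vertex_degree T (vs ! 1) \<le> 1 \<and>
      vertex_degree T (vs ! (length vs - 1)) \<le> 1 \<and> outerplanar_diagram V (E - T) D"
proof -
  let ?n = "length vs"
  have vs: "distinct vs" "set vs = V" using assms(3) unfolding clockwise_order_def by auto
  have DD: "disk_drawing V E D" and one: "\<And>e. e \<in> E \<Longrightarrow> card {f \<in> E. crosses D e f} \<le> 1"
    using assms(2) unfolding pseudo_outerplanar_diagram_def one_crossing_drawing_def by blast+
  have "finite V" "E \<subseteq> Pow V" using assms(1) unfolding simple_graph_def by auto
  then have finE: "finite E" using finite_subset by blast
  have cross: "crosses D e f \<longleftrightarrow> list_interleaved vs e f" if "e \<in> E" "f \<in> E" for e f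
    using crosses_iff_interleaved[OF assms(1-3) that] .
  have inj: "inj_on ((!) vs) {..<?n}" using vs(1) by (simp add: inj_on_nth)
  have range: "{0..?n - 1} = {..<?n}" using assms(4) by auto
  define F where "F = {s. s \<subseteq> {..<?n} \<and> (!) vs ` s \<in> E}"
  have F_cross: "crosses D ((!) vs ` s) ((!) vs ` t)" if "s \<in> F" "t \<in> F" "interleaved s t" for s t
  proof -
    have "list_interleaved vs ((!) vs ` s) ((!) vs ` t)"
      using that unfolding list_interleaved_def F_def by blast
    then show ?thesis using cross that unfolding F_def by blast
  qed
  \<comment> \<open>The limit of one crossing per edge turns into uniqueness of the interleaved
    partner.\<close>
  have F_one: "t = u" if stu: "s \<in> F" "t \<in> F" "u \<in> F" "interleaved s t" "interleaved s u" for s t u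
  proof -
    let ?C = "{f \<in> E. crosses D ((!) vs ` s) f}"
    have "(!) vs ` s \<in> E" using stu(1) unfolding F_def by simp
    moreover have "(!) vs ` t \<in> ?C" "(!) vs ` u \<in> ?C"
      using F_cross stu unfolding F_def by simp_all
    ultimately have "(!) vs ` t = (!) vs ` u"
      using one finE card_le_Suc0_iff_eq[of ?C] by force
    then show ?thesis using inj_on_image_eq_iff[OF inj, of t u] stu unfolding F_def by simp
  qed
  have bounds: "0 < ?n" "1 < ?n" "?n - 1 < ?n" "0 < ?n - 1" using assms(4) by linarith+
  have "\<exists>T. uncrossing F 0 (?n - 1) T \<and> vertex_degree T 0 = 0 \<and>
      vertex_degree T (Suc 0) \<le> 1 \<and> vertex_degree T (?n - 1) \<le> 1"
    by (rule conjunct1[OF uncrossing_exists[OF _ bounds(4)]]) (use F_one in metis)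
  then obtain T where T: "uncrossing F 0 (?n - 1) T" "vertex_degree T 0 = 0"
      "vertex_degree T (Suc 0) \<le> 1" "vertex_degree T (?n - 1) \<le> 1"
    by blast
  let ?T = "(`) ((!) vs) ` T"
  have mem: "\<exists>t. s \<in> F \<and> t \<in> F \<and> interleaved s t" if "s \<in> T" for s
    using uncrossing_member[OF T(1) that] by metis
  have "T \<subseteq> F" using mem by blast
  then have TE: "?T \<subseteq> E" unfolding F_def by blast
  have Tn: "s \<subseteq> {..<?n}" if "s \<in> T" for s using \<open>T \<subseteq> F\<close> that unfolding F_def by blast
  have "linear_layout {..<?n} T" using uncrossing_layout[OF T(1)] unfolding range .
  then have "linear_layout ((!) vs ` {..<?n}) ?T" by (rule linear_layout_image[OF inj])
  moreover have "(!) vs ` {..<?n} = V" unfolding vs(2)[symmetric] by (auto simp: set_conv_nth)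
  ultimately have layout: "linear_layout V ?T" by metis
  have "simple_graph V ?T" using assms(1) TE unfolding simple_graph_def by (meson subsetD)
  then have "linear_forest V ?T" using layout by (rule linear_layout_linear_forest)
  moreover have "?T \<subseteq> crossing_chords E D vs"
  proof
    fix e assume "e \<in> ?T"
    then obtain s t where st: "e = (!) vs ` s" "s \<in> F" "t \<in> F" "interleaved s t" using mem by blast
    define f where "f = (!) vs ` t"
    have ef: "e \<in> E" "f \<in> E" "crosses D e f" using st F_cross unfolding F_def f_def by simp_all
    then have "list_interleaved vs e f" using cross by simp
    then have "e \<notin> cycle_edges vs" "f \<notin> cycle_edges vs"
      using interleaved_not_cycle_edge[OF vs(1)] list_interleaved_sym by blast+
    then show "e \<in> crossing_chords E D vs"
      using ef unfolding crossing_chords_def chords_def by blast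
  qed
  moreover have deg: "vertex_degree ?T (vs ! k) = vertex_degree T k" if "k < ?n" for k
    using vertex_degree_image[OF inj Tn, of T k] that by simp
  have "vertex_degree ?T (vs ! 0) = 0" "vertex_degree ?T (vs ! 1) \<le> 1"
      "vertex_degree ?T (vs ! (?n - 1)) \<le> 1"
    unfolding deg[OF bounds(1)] deg[OF bounds(2)] deg[OF bounds(3)] using T(2-4) by simp_all
  moreover have "outerplanar_diagram V (E - ?T) D"
    unfolding outerplanar_diagram_def
  proof (intro conjI ballI notI)
    show "disk_drawing V (E - ?T) D" by (rule disk_drawing_subset[OF DD]) blast
    fix e f assume ef: "e \<in> E - ?T" "f \<in> E - ?T" "crosses D e f"
    then have "list_interleaved vs e f" using cross by simp
    then obtain s t where st: "s \<subseteq> {..<?n}" "t \<subseteq> {..<?n}" "interleaved s t"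
        "e = (!) vs ` s" "f = (!) vs ` t"
      unfolding list_interleaved_def by blast
    then have "s \<in> T \<or> t \<in> T"
      using uncrossing_hits[OF T(1), of s t] ef range unfolding F_def by simp
    then show False using ef st by blast
  qed
  ultimately show ?thesis using TE by blast
qed

theorem theorem3p1:
  fixes V :: "'a set" and E :: "'a set set" and D :: "'a drawing" and vs :: "'a list"
    and x y z :: 'a
  assumes "simple_graph V E"
    and "two_connected V E"
    and "hamiltonian_diagram V E D vs"
    and "y \<in> set vs"
    and "{y, x} \<in> cycle_edges vs" and "{y, z} \<in> cycle_edges vs" and "x \<noteq> z"
  shows "\<exists>VT ET. VT \<subseteq> V \<and> ET \<subseteq> E \<and> linear_forest VT ET \<and>
      ET \<subseteq> crossing_chords E D vs \<and>
      vertex_degree ET y = 0 \<and>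
      max (vertex_degree ET x) (vertex_degree ET z) \<le> 1 \<and>
      outerplanar_diagram V (E - ET) D"
proof -
  have diag: "pseudo_outerplanar_diagram V E D" and order: "clockwise_order V D vs"
    and cyc: "cycle_edges vs \<subseteq> E"
    using assms(3) unfolding hamiltonian_diagram_def by auto
  obtain m where m: "m < length vs" "vs ! m = y" using assms(4) by (metis in_set_conv_nth)
  \<comment> \<open>Cutting the cycle at \<open>y\<close> makes its neighbours the entries 1 and
    \<open>length ws - 1\<close>.\<close>
  define ws where "ws = rotate m vs"
  have ws: "clockwise_order V D ws" "cycle_edges ws = cycle_edges vs"
    unfolding ws_def using clockwise_order_rotate[OF order] by auto
  have len: "length ws = length vs" by (simp add: ws_def)
  have "card V = length vs"
    using order distinct_card unfolding clockwise_order_def by blast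
  then have n: "length ws > 2" using assms(2) len unfolding two_connected_def by simp
  have "0 < length vs" using m(1) by linarith
  then have y: "ws ! 0 = y" using m nth_rotate[of 0 vs m] by (simp add: ws_def)
  have dist: "distinct ws" using ws(1) unfolding clockwise_order_def by simp
  have nbr: "u = ws ! 1 \<or> u = ws ! (length ws - 1)" if "{y, u} \<in> cycle_edges ws" for u
  proof -
    have e: "{y, u} \<in> E" using that ws(2) cyc by blast
    obtain p q where pq: "p < q" "q < length ws" "{y, u} = {ws ! p, ws ! q}"
      using edge_as_indices[OF assms(1) _ dist e] ws(1) unfolding clockwise_order_def by metis
    then have "ws ! 0 = ws ! p \<and> u = ws ! q \<or> ws ! 0 = ws ! q"
      using y by (auto simp: doubleton_eq_iff)
    moreover have "0 < length ws" using n by linarith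
    then have "ws ! 0 = ws ! i \<longleftrightarrow> i = 0" if "i < length ws" for i
      using nth_eq_iff_index_eq[OF dist _ that, of 0] by metis
    ultimately have "p = 0 \<and> u = ws ! q \<or> q = 0" using pq(1,2) by simp
    then have u: "p = 0" "u = ws ! q" using pq(1) by auto
    then have "q = Suc 0 \<or> Suc q = length ws"
      using cycle_edges_index[OF dist _ pq(1,2)] that pq(3) by auto
    then have "q = 1 \<or> q = length ws - 1" by linarith
    then show ?thesis using u(2) by blast
  qed
  obtain T where T: "T \<subseteq> E" "linear_forest V T" "T \<subseteq> crossing_chords E D ws"
      "vertex_degree T (ws ! 0) = 0" "vertex_degree T (ws ! 1) \<le> 1"
      "vertex_degree T (ws ! (length ws - 1)) \<le> 1" "outerplanar_diagram V (E - T) D"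
    using linear_forest_removal_at_first_vertex[OF assms(1) diag ws(1)] n by auto
  have "vertex_degree T u \<le> 1" if "{y, u} \<in> cycle_edges vs" for u
    using nbr[of u] that T(5,6) ws(2) by auto
  then have "max (vertex_degree T x) (vertex_degree T z) \<le> 1" using assms(5,6) by simp
  moreover have "T \<subseteq> crossing_chords E D vs" using T(3) crossing_chords_cong[OF ws(2)] by simp
  \<comment> \<open>The forest is taken on all of \<open>V\<close>; vertices without a selected edge
    are one-point paths.\<close>
  ultimately show ?thesis using T y by (intro exI[of _ V] exI[of _ T]) simp
qed

end
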